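(* Let $n,d,T\ge1$ be integers and let $p,q\in[1,\infty]$ be Hölder conjugates. Let $f_1,\dots,f_n:\mathbb{R}^d\to\mathbb{R}$ be continuously differentiable and let $L_q>0$ be such that $\|\nabla f_i(x)-\nabla f_i(y)\|_p\le L_q\|x-y\|_q$ for all $i\in\{1,\dots,n\}$ and $x,y\in\mathbb{R}^d$. Let $f=\frac1n\sum_{i=1}^nf_i$ and assume that $f$ is convex and admits a global minimizer $x_*$; write $f_*=f(x_* )$. Let $\mathsf P>0$, $\alpha>0$, and set $\gamma=\frac{\alpha}{\sqrt{dT}}$, $D=\frac{\mathsf P}{\sqrt T}$. Let $(x_t)$ be the iterates of SignSVRG, Variant 1 (see context), run from $x_1\in\mathbb{R}^d$ with parameters $L_q,D,\gamma$, and let $\bar x_T$ be drawn uniformly at random from $\{x_1,\dots,x_T\}$ (uniform index in $\{1,\dots,T\}$, independent of everything else). Then $$\mathbb{E}\big[\sqrt{f(\bar x_T)-f_*}\big]\le\sqrt{\frac{2L_q}{T}}\,\max\left(\mathsf P,\;\sqrt d\left(\frac{\|x_1-x_*\|^2}{\alpha}+\alpha\right)\right).$$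
   Context: $\|\cdot\|$ is the Euclidean norm, $\|\cdot\|_r$ the $\ell_r$-norm on $\mathbb{R}^d$; $\mathrm{sign}$ acts coordinate-wise with $\mathrm{sign}(0)=0$. SignSVRG algorithm, Variant 1. Input: deterministic $x_1\in\mathbb{R}^d$, $L_q,D,\gamma>0$. Set $k(1)=1$, $\tilde x_1=x_1$ (initial reference point), $g_1=\nabla f(x_1)$. For $t=1,\dots,T$: 1. Sample $i_t$ uniformly on $\{1,\dots,n\}$ and $U_t$ uniformly on $[-1,1]^d$, independent of each other and of the past. 2. Set the scalar $G_t=L_q\|x_t-\tilde x_{k(t)}\|_q+\|g_{k(t)}\|_p$. 3. Set $x_t^+=x_t-\gamma\,\mathrm{sign}\big(\nabla f_{i_t}(x_t)-\nabla f_{i_t}(\tilde x_{k(t)})+g_{k(t)}+G_tU_t\big)$ and $x_{t+1}=x_t^+$. 4. If $\|x_t^+-\tilde x_{k(t)}\|_q\le D$, keep the reference point: $k(t+1)=k(t)$. Otherwise update it: $k(t+1)=k(t)+1$, $\tilde x_{k(t+1)}=x_t^+$, $g_{k(t+1)}=\nabla f(x_t^+)$. *)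

theory Defs
  imports "HOL-Probability.Probability"
begin

definition lr_norm :: "ereal \<Rightarrow> real^'d \<Rightarrow> real" where
  "lr_norm r x =
     (if r = \<infinity> then infnorm x
      else (\<Sum>i\<in>UNIV. \<bar>x $ i\<bar> powr real_of_ereal r) powr (1 / real_of_ereal r))"

definition sign_vec :: "real^'d \<Rightarrow> real^'d" where
  "sign_vec v = (\<chi> i. sgn (v $ i))"

text \<open>The gradient is only meaningful where the function is differentiable; there it is the
  unique vector satisfying the library's gradient predicate (lemma \<open>grad_eqI\<close> below).\<close>

definition grad :: "('a::euclidean_space \<Rightarrow> real) \<Rightarrow> 'a \<Rightarrow> 'a" where
  "grad f x = (THE v. GDERIV f x :> v)"

lemma grad_eqI:
  assumes "GDERIV f x :> v"
  shows "grad f x = v"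
  unfolding grad_def
proof (rule the_equality)
  show "GDERIV f x :> v" by fact
next
  fix w assume "GDERIV f x :> w"
  with assms have "(\<lambda>h. inner h w) = (\<lambda>h. inner h v)"
    unfolding gderiv_def by (rule has_derivative_unique[rotated])
  then show "w = v"
    by (metis inner_commute vector_eq_rdot)
qed

definition cont_differentiable :: "('a::euclidean_space \<Rightarrow> real) \<Rightarrow> bool" where
  "cont_differentiable f \<longleftrightarrow> (\<forall>x. f differentiable (at x)) \<and> continuous_on UNIV (grad f)"

lemma GDERIV_grad:
  assumes "f differentiable (at x)"
  shows "GDERIV f x :> grad f x"
proof -
  from assms obtain f' where f': "(f has_derivative f') (at x)"
    by (auto simp: differentiable_def)
  interpret linear f' by (rule has_derivative_linear[OF f'])
  have "f' = (\<lambda>h. inner h (adjoint f' 1))"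
    using adjoint_clauses(1)[OF has_derivative_linear[OF f']] by (auto simp: inner_real_def)
  with f' have "GDERIV f x :> adjoint f' 1"
    by (simp add: gderiv_def)
  then show ?thesis
    using grad_eqI by metis
qed

definition avg_fun :: "(nat \<Rightarrow> 'a \<Rightarrow> real) \<Rightarrow> nat \<Rightarrow> 'a \<Rightarrow> real" where
  "avg_fun f n x = (\<Sum>i = 1..n. f i x) / real n"

text \<open>The reference point and its gradient are stored directly, so the counter \<open>k(t)\<close>, which only
  labels them, is not needed: at time \<open>t\<close>, \<open>ref_point\<close> is \<open>\<tilde>x\<^bsub>k(t)\<^esub>\<close> and \<open>ref_grad\<close> is \<open>g\<^bsub>k(t)\<^esub>\<close>.\<close>

record ('d::finite) svrg_state =
  iterate :: "real^'d"
  ref_point :: "real^'d"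
  ref_grad :: "real^'d"

definition signsvrg_step ::
  "(nat \<Rightarrow> real^'d \<Rightarrow> real) \<Rightarrow> nat \<Rightarrow> ereal \<Rightarrow> ereal \<Rightarrow> real \<Rightarrow> real \<Rightarrow> real \<Rightarrow>
   nat \<Rightarrow> real^'d \<Rightarrow> 'd svrg_state \<Rightarrow> 'd svrg_state" where
  "signsvrg_step f n p q L D \<gamma> i u s =
     (let x = iterate s; xr = ref_point s; g = ref_grad s;
          G = L * lr_norm q (x - xr) + lr_norm p g;
          x' = x - \<gamma> *\<^sub>R sign_vec (grad (f i) x - grad (f i) xr + g + G *\<^sub>R u)
      in if lr_norm q (x' - xr) \<le> D
         then \<lparr>iterate = x', ref_point = xr, ref_grad = g\<rparr>
         else \<lparr>iterate = x', ref_point = x', ref_grad = grad (avg_fun f n) x'\<rparr>)"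

text \<open>\<open>signsvrg_state \<dots> I U x1 m\<close> is the state after \<open>m\<close> steps along the sample sequences \<open>I\<close>, \<open>U\<close>
  (step \<open>t\<close> uses \<open>I t\<close> and \<open>U t\<close>, starting with \<open>t = 1\<close>), so the iterate \<open>x\<^sub>t\<close> for
  \<open>t \<ge> 1\<close> is that of the state after \<open>t - 1\<close> steps.\<close>

primrec signsvrg_state ::
  "(nat \<Rightarrow> real^'d \<Rightarrow> real) \<Rightarrow> nat \<Rightarrow> ereal \<Rightarrow> ereal \<Rightarrow> real \<Rightarrow> real \<Rightarrow> real \<Rightarrow>
   (nat \<Rightarrow> nat) \<Rightarrow> (nat \<Rightarrow> real^'d) \<Rightarrow> real^'d \<Rightarrow> nat \<Rightarrow> 'd svrg_state" where
  "signsvrg_state f n p q L D \<gamma> I U x1 0 =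
     \<lparr>iterate = x1, ref_point = x1, ref_grad = grad (avg_fun f n) x1\<rparr>"
| "signsvrg_state f n p q L D \<gamma> I U x1 (Suc m) =
     signsvrg_step f n p q L D \<gamma> (I (Suc m)) (U (Suc m)) (signsvrg_state f n p q L D \<gamma> I U x1 m)"

definition signsvrg_iterate ::
  "(nat \<Rightarrow> real^'d \<Rightarrow> real) \<Rightarrow> nat \<Rightarrow> ereal \<Rightarrow> ereal \<Rightarrow> real \<Rightarrow> real \<Rightarrow> real \<Rightarrow>
   (nat \<Rightarrow> nat) \<Rightarrow> (nat \<Rightarrow> real^'d) \<Rightarrow> real^'d \<Rightarrow> nat \<Rightarrow> real^'d" where
  "signsvrg_iterate f n p q L D \<gamma> I U x1 t = iterate (signsvrg_state f n p q L D \<gamma> I U x1 (t - 1))"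

text \<open>The library's \<open>indep_var\<close> requires both random variables to have the same value type.\<close>

definition (in prob_space) indep_pair ::
  "'b measure \<Rightarrow> ('a \<Rightarrow> 'b) \<Rightarrow> 'c measure \<Rightarrow> ('a \<Rightarrow> 'c) \<Rightarrow> bool" where
  "indep_pair MX X MY Y \<longleftrightarrow>
     random_variable MX X \<and> random_variable MY Y \<and>
     indep_set {X -` A \<inter> space M | A. A \<in> sets MX} {Y -` B \<inter> space M | B. B \<in> sets MY}"

end

theory Submission
  imports Defs
begin

text \<open>The noise scale \<open>G\<close> dominates every component of the stochastic direction, so the sign of
  \<open>v + G u\<close> with \<open>u\<close> uniform on \<open>[-1, 1]\<close> has mean \<open>v / G\<close>: in expectation each step is a gradient
  step of length \<open>\<gamma> / G\<close>. Convexity then gives the usual recursion for \<open>\<parallel>x\<^sub>t - x\<^sub>*\<parallel>\<^sup>2\<close> with progress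
  \<open>s\<^sup>2 / G\<close>, where \<open>s\<^sup>2 = f(x\<^sub>t) - f\<^sub>*\<close>. Since the reference point is within \<open>D\<close> of \<open>x\<^sub>t\<close> and
  \<open>\<parallel>\<nabla>f(x\<^sub>t)\<parallel>\<^sub>p \<le> \<surd>(2L) s\<close> by smoothness, \<open>G \<le> \<surd>(2L) (\<mu> + s)\<close> where \<open>\<mu>\<close> is the claimed bound, and
  replacing the convex function \<open>s\<^sup>2 / (\<mu> + s)\<close> by its tangent at \<open>s = \<mu>\<close> makes the telescoped recursion
  linear in \<open>s\<close>.\<close>

section \<open>The \<open>\<ell>\<^sub>r\<close>-norms and their duality\<close>

text \<open>Extended-real division gives \<open>1 / \<infinity> = 0\<close>, so an exponent 1 forces
  the other one to be infinite. In the remaining case both exponents are finite and above 1, as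
  Young's inequality requires.\<close>

lemma conjugate_exponent_cases [consumes 3, case_names one_infinity infinity_one finite]:
  fixes p q :: ereal
  assumes "1 \<le> p" "1 \<le> q" "1 / p + 1 / q = 1"
  obtains "p = 1" "q = \<infinity>" | "p = \<infinity>" "q = 1"
  | a b :: real where "p = ereal a" "q = ereal b" "a > 1" "b > 1" "1 / a + 1 / b = 1"
proof (cases p)
  case (real a)
  then have a: "a \<ge> 1" using assms(1) by (simp add: one_ereal_def)
  show ?thesis
  proof (cases q)
    case q: (real b)
    then have b: "b \<ge> 1" using assms(2) by (simp add: one_ereal_def)
    have s: "1 / a + 1 / b = 1"
      using assms(3) a b unfolding real q by (simp add: one_ereal_def)
    moreover have "a \<noteq> 1" "b \<noteq> 1" using s a b by auto
    ultimately show ?thesis using that(3)[OF real q] a b by simp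
  next
    case PInf
    then have "1 / a = 1"
      using assms(3) a unfolding real by (simp add: one_ereal_def)
    then show ?thesis using that(1) real PInf by (simp add: one_ereal_def)
  next
    case MInf
    then show ?thesis using assms(2) by simp
  qed
next
  case PInf
  show ?thesis
  proof (cases q)
    case q: (real b)
    then have b: "b \<ge> 1" using assms(2) by (simp add: one_ereal_def)
    have "1 / b = 1" using assms(3) b unfolding PInf q by (simp add: one_ereal_def)
    then show ?thesis using that(2) PInf q by (simp add: one_ereal_def)
  qed (use assms PInf in auto)
next
  case MInf
  then show ?thesis using assms(1) by simp
qed

lemma lr_norm_nonneg [simp]: "lr_norm r x \<ge> 0"
  by (simp add: lr_norm_def infnorm_pos_le)

lemma lr_norm_one: "lr_norm 1 x = (\<Sum>i\<in>UNIV. \<bar>x $ i\<bar>)"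
  by (simp add: lr_norm_def one_ereal_def[symmetric] sum_nonneg)

lemma lr_norm_infinity: "lr_norm \<infinity> x = infnorm x"
  by (simp add: lr_norm_def)

lemma lr_norm_ereal: "lr_norm (ereal a) x = (\<Sum>i\<in>UNIV. \<bar>x $ i\<bar> powr a) powr (1 / a)"
  by (simp add: lr_norm_def)

lemma lr_norm_scaleR:
  assumes "1 \<le> r"
  shows "lr_norm r (c *\<^sub>R x) = \<bar>c\<bar> * lr_norm r x"
proof (cases r)
  case (real a)
  then have a: "a \<ge> 1" using assms by (simp add: one_ereal_def)
  have "(\<Sum>i\<in>UNIV. \<bar>(c *\<^sub>R x) $ i\<bar> powr a) = \<bar>c\<bar> powr a * (\<Sum>i\<in>UNIV. \<bar>x $ i\<bar> powr a)"
    by (simp add: abs_mult powr_mult sum_distrib_left)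
  then show ?thesis
    using a by (simp add: real lr_norm_ereal powr_mult sum_nonneg powr_powr)
qed (use assms in \<open>auto simp: lr_norm_infinity infnorm_mul\<close>)

lemma lr_norm_zero [simp]: "1 \<le> r \<Longrightarrow> lr_norm r 0 = 0"
  using lr_norm_scaleR[of r 0 0] by simp

text \<open>A single component contributes one summand under the root. This yields definiteness of
  the norm, and later lets a norm bound dominate every coordinate of the stochastic
  direction.\<close>

lemma component_le_lr_norm:
  assumes "1 \<le> r"
  shows "\<bar>x $ j\<bar> \<le> lr_norm r x"
proof (cases r)
  case (real a)
  then have a: "a \<ge> 1" using assms by (simp add: one_ereal_def)
  have "\<bar>x $ j\<bar> powr a \<le> (\<Sum>i\<in>UNIV. \<bar>x $ i\<bar> powr a)"
    by (rule member_le_sum) auto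
  then have "(\<bar>x $ j\<bar> powr a) powr (1 / a) \<le> (\<Sum>i\<in>UNIV. \<bar>x $ i\<bar> powr a) powr (1 / a)"
    using a by (intro powr_mono2) auto
  then show ?thesis using a by (simp add: real lr_norm_ereal powr_powr)
qed (use assms in \<open>auto simp: lr_norm_infinity component_le_infnorm_cart\<close>)

lemma lr_norm_eq_0:
  assumes "1 \<le> r" "lr_norm r x = 0"
  shows "x = 0"
  using component_le_lr_norm[OF assms(1), of x] assms(2) by (simp add: vec_eq_iff)

text \<open>Young's inequality is applied in each coordinate; the powers sum to 1 by normalization,
  leaving \<open>1 / a + 1 / b = 1\<close>.\<close>

lemma Holder_inequality_normalized:
  fixes x y :: "real^'d"
  assumes ab: "a > 1" "b > 1" "1 / a + 1 / b = 1"
    and "lr_norm (ereal a) x = 1" "lr_norm (ereal b) y = 1"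
  shows "x \<bullet> y \<le> 1"
proof -
  have sx: "(\<Sum>i\<in>UNIV. \<bar>x $ i\<bar> powr a) = 1"
  proof -
    have "lr_norm (ereal a) x powr a = (\<Sum>i\<in>UNIV. \<bar>x $ i\<bar> powr a)"
      using ab by (simp add: lr_norm_ereal powr_powr sum_nonneg)
    then show ?thesis using assms by simp
  qed
  have sy: "(\<Sum>i\<in>UNIV. \<bar>y $ i\<bar> powr b) = 1"
  proof -
    have "lr_norm (ereal b) y powr b = (\<Sum>i\<in>UNIV. \<bar>y $ i\<bar> powr b)"
      using ab by (simp add: lr_norm_ereal powr_powr sum_nonneg)
    then show ?thesis using assms by simp
  qed
  have "x \<bullet> y \<le> (\<Sum>i\<in>UNIV. \<bar>x $ i\<bar> powr a / a + \<bar>y $ i\<bar> powr b / b)"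
    unfolding inner_vec_def
  proof (rule sum_mono)
    fix i
    have "x $ i \<bullet> y $ i \<le> \<bar>x $ i\<bar> * \<bar>y $ i\<bar>"
      by (simp add: abs_mult[symmetric])
    also have "\<dots> \<le> \<bar>x $ i\<bar> powr a / a + \<bar>y $ i\<bar> powr b / b"
      using ab by (intro Youngs_inequality) auto
    finally show "x $ i \<bullet> y $ i \<le> \<dots>" .
  qed
  also have "\<dots> = 1"
    using ab by (simp add: sum.distrib sum_divide_distrib[symmetric] sx sy)
  finally show ?thesis .
qed

text \<open>For the endpoint pair each component of one vector is bounded by the maximum norm. For
  finite exponents, homogeneity reduces the claim to vectors of norm 1.\<close>

lemma inner_le_lr_norm:
  fixes x y :: "real^'d"
  assumes "1 \<le> p" "1 \<le> q" "1 / p + 1 / q = 1"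
  shows "x \<bullet> y \<le> lr_norm p x * lr_norm q y"
proof -
  have one_inf: "x \<bullet> y \<le> lr_norm 1 x * lr_norm \<infinity> y" for x y :: "real^'d"
  proof -
    have "x \<bullet> y \<le> (\<Sum>i\<in>UNIV. \<bar>x $ i\<bar> * infnorm y)"
      unfolding inner_vec_def
    proof (rule sum_mono)
      fix i
      have "x $ i \<bullet> y $ i \<le> \<bar>x $ i\<bar> * \<bar>y $ i\<bar>"
        by (simp add: abs_mult[symmetric])
      also have "\<dots> \<le> \<bar>x $ i\<bar> * infnorm y"
        by (intro mult_left_mono component_le_infnorm_cart) auto
      finally show "x $ i \<bullet> y $ i \<le> \<bar>x $ i\<bar> * infnorm y" .
    qed
    then show ?thesis by (simp add: lr_norm_one lr_norm_infinity sum_distrib_right)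
  qed
  from assms show ?thesis
  proof (cases rule: conjugate_exponent_cases)
    case one_infinity
    then show ?thesis using one_inf by simp
  next
    case infinity_one
    then show ?thesis using one_inf[of y x] by (simp add: inner_commute mult.commute)
  next
    case (finite a b)
    show ?thesis
    proof (cases "lr_norm p x = 0 \<or> lr_norm q y = 0")
      case True
      then have "x = 0 \<or> y = 0" using assms lr_norm_eq_0 by blast
      then show ?thesis by auto
    next
      case False
      then have pos: "lr_norm p x > 0" "lr_norm q y > 0"
        using lr_norm_nonneg[of p x] lr_norm_nonneg[of q y] by linarith+
      have "(x /\<^sub>R lr_norm p x) \<bullet> (y /\<^sub>R lr_norm q y) \<le> 1"
      proof (rule Holder_inequality_normalized[OF finite(3,4,5)])
        show "lr_norm (ereal a) (x /\<^sub>R lr_norm p x) = 1"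
          using pos by (simp only: finite(1)[symmetric] lr_norm_scaleR[OF assms(1)]) simp
        show "lr_norm (ereal b) (y /\<^sub>R lr_norm q y) = 1"
          using pos by (simp only: finite(2)[symmetric] lr_norm_scaleR[OF assms(2)]) simp
      qed
      then show ?thesis using pos by (simp add: field_simps)
    qed
  qed
qed

text \<open>The witness is the equality case of Hoelder's inequality: the sign vector, a signed unit
  vector at a largest component, or the normalized vector of signed powers. It gives the triangle
  inequality without cases and the descent direction for smooth functions.\<close>

lemma lr_norm_dual_attained:
  fixes x :: "real^'d"
  assumes "1 \<le> p" "1 \<le> q" "1 / p + 1 / q = 1"
  obtains u where "lr_norm q u \<le> 1" "x \<bullet> u = lr_norm p x"
  using assms
proof (cases rule: conjugate_exponent_cases)
  case one_infinity
  let ?u = "\<chi> i. sgn (x $ i)"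
  have "x \<bullet> ?u = lr_norm 1 x"
    by (simp add: inner_vec_def lr_norm_one abs_sgn[symmetric])
  moreover have "infnorm ?u \<le> 1"
    unfolding infnorm_cart by (rule cSup_least) (auto simp: sgn_if)
  ultimately show ?thesis using that one_infinity by (simp add: lr_norm_infinity)
next
  case infinity_one
  \<comment> \<open>There are finitely many components, so the supremum is attained at some index
    \<open>j\<close>.\<close>
  have "{\<bar>x $ i\<bar> |i. i \<in> UNIV} = range (\<lambda>i. \<bar>x $ i\<bar>)" by auto
  then have "infnorm x \<in> range (\<lambda>i. \<bar>x $ i\<bar>)"
    unfolding infnorm_cart by (simp add: cSup_eq_Max)
  then obtain j where j: "infnorm x = \<bar>x $ j\<bar>" by auto
  let ?u = "axis j (sgn (x $ j))"
  have "x \<bullet> ?u = lr_norm p x"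
    by (simp add: inner_axis infinity_one lr_norm_infinity j abs_sgn[symmetric])
  moreover have "lr_norm 1 ?u \<le> 1"
  proof -
    have "(\<Sum>i\<in>UNIV. \<bar>?u $ i\<bar>) = (\<Sum>i\<in>UNIV. if i = j then \<bar>sgn (x $ j)\<bar> else 0)"
      by (rule sum.cong) (auto simp: axis_def)
    then show ?thesis by (simp add: lr_norm_one sgn_if)
  qed
  ultimately show ?thesis using that infinity_one by simp
next
  case (finite a b)
  show ?thesis
  proof (cases "x = 0")
    case True
    then show ?thesis using that[of 0] assms by simp
  next
    case False
    define S where "S = (\<Sum>i\<in>UNIV. \<bar>x $ i\<bar> powr a)"
    have px: "lr_norm p x = S powr (1 / a)" by (simp add: finite lr_norm_ereal S_def)
    have "S \<noteq> 0" using False lr_norm_eq_0[OF assms(1), of x] px by auto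
    moreover have "S \<ge> 0" by (simp add: S_def sum_nonneg)
    ultimately have S: "S > 0" by simp
    \<comment> \<open>Since \<open>(a - 1) * b = a\<close>, the unscaled vector has
      \<open>b\<close>-norm exactly \<open>S powr (1 / b)\<close>, which explains the
      normalization.\<close>
    define u where "u = (\<chi> i. sgn (x $ i) * \<bar>x $ i\<bar> powr (a - 1)) /\<^sub>R S powr (1 / b)"
    have conj: "(a - 1) * b = a" "1 - 1 / b = 1 / a" using finite by (auto simp: field_simps)
    have "x \<bullet> u = (\<Sum>i\<in>UNIV. \<bar>x $ i\<bar> powr a) / S powr (1 / b)"
    proof -
      have "x $ i * (sgn (x $ i) * \<bar>x $ i\<bar> powr (a - 1)) = \<bar>x $ i\<bar> powr a" for i
        by (cases "x $ i = 0") (auto simp: powr_diff sgn_if)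
      then show ?thesis
        unfolding u_def by (simp add: inner_vec_def field_simps flip: sum_divide_distrib)
    qed
    also have "\<dots> = S powr (1 - 1 / b)"
      using S by (simp add: S_def[symmetric] powr_diff)
    finally have "x \<bullet> u = lr_norm p x" by (simp add: conj px)
    moreover have "lr_norm q u = 1"
    proof -
      have "\<bar>sgn (x $ i) * \<bar>x $ i\<bar> powr (a - 1)\<bar> powr b = \<bar>x $ i\<bar> powr a" for i
        using finite by (cases "x $ i = 0") (auto simp: abs_mult powr_powr conj)
      then have "lr_norm q (\<chi> i. sgn (x $ i) * \<bar>x $ i\<bar> powr (a - 1)) = S powr (1 / b)"
        by (simp add: finite lr_norm_ereal S_def)
      then show ?thesis
        using S by (simp add: u_def lr_norm_scaleR[OF assms(2)])
    qed
    ultimately show ?thesis using that[of u] by simp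
  qed
qed

text \<open>Testing against the dual vector \<open>u\<close> of \<open>x + y\<close> turns its norm
  into a linear expression, and each summand tested against \<open>u\<close> is at most its own
  norm.\<close>

lemma lr_norm_triangle:
  fixes x y :: "real^'d"
  assumes "1 \<le> p" "1 \<le> q" "1 / p + 1 / q = 1"
  shows "lr_norm p (x + y) \<le> lr_norm p x + lr_norm p y"
proof -
  obtain u where u: "lr_norm q u \<le> 1" "(x + y) \<bullet> u = lr_norm p (x + y)"
    using lr_norm_dual_attained[OF assms] by metis
  have le: "z \<bullet> u \<le> lr_norm p z" for z
    using inner_le_lr_norm[OF assms, of z u] u(1) mult_left_mono[OF u(1), of "lr_norm p z"]
    by simp
  have "lr_norm p (x + y) = x \<bullet> u + y \<bullet> u" by (simp add: u(2)[symmetric] inner_add_left)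
  then show ?thesis using le[of x] le[of y] by simp
qed

lemma lr_norm_sum:
  fixes x :: "'i \<Rightarrow> real^'d"
  assumes "1 \<le> p" "1 \<le> q" "1 / p + 1 / q = 1"
  shows "lr_norm p (\<Sum>i\<in>A. x i) \<le> (\<Sum>i\<in>A. lr_norm p (x i))"
proof (induction A rule: infinite_finite_induct)
  case (insert j A)
  have "lr_norm p (x j + (\<Sum>i\<in>A. x i)) \<le> lr_norm p (x j) + lr_norm p (\<Sum>i\<in>A. x i)"
    by (rule lr_norm_triangle[OF assms])
  then show ?case using insert by simp
qed (use assms in auto)

section \<open>Convex and smooth functions\<close>

text \<open>The chain rule along a line, which reduces the next two results to functions of one real
  variable.\<close>

lemma GDERIV_along_line:
  fixes h :: "'a::euclidean_space \<Rightarrow> real"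
  assumes "h differentiable (at (x + t *\<^sub>R v))"
  shows "((\<lambda>t. h (x + t *\<^sub>R v)) has_real_derivative (grad h (x + t *\<^sub>R v) \<bullet> v)) (at t)"
proof -
  have "((\<lambda>t. x + t *\<^sub>R v) has_derivative (\<lambda>s. s *\<^sub>R v)) (at t)"
    by (auto intro!: derivative_eq_intros)
  from diff_chain_at[OF this GDERIV_grad[OF assms, unfolded gderiv_def]]
  have "((\<lambda>t. h (x + t *\<^sub>R v)) has_derivative (\<lambda>s. (s *\<^sub>R v) \<bullet> grad h (x + t *\<^sub>R v))) (at t)"
    by (simp add: o_def)
  then show ?thesis
    unfolding has_field_derivative_def
    by (rule has_derivative_eq_rhs) (auto simp: inner_commute mult.commute)
qed

text \<open>The restriction of \<open>h\<close> to the line through \<open>x\<close> and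
  \<open>y\<close> is convex; its tangent at parameter 0 is compared with its value at parameter
  1.\<close>

lemma convex_gradient_inequality:
  fixes h :: "'a::euclidean_space \<Rightarrow> real"
  assumes "convex_on UNIV h" "h differentiable (at x)"
  shows "h y \<ge> h x + grad h x \<bullet> (y - x)"
proof -
  let ?l = "\<lambda>t. h (x + t *\<^sub>R (y - x))"
  have "convex_on UNIV ?l"
  proof (rule convex_onI)
    fix t r s :: real assume t: "0 < t" "t < 1"
    have "x + ((1 - t) *\<^sub>R r + t *\<^sub>R s) *\<^sub>R (y - x) =
        (1 - t) *\<^sub>R (x + r *\<^sub>R (y - x)) + t *\<^sub>R (x + s *\<^sub>R (y - x))"
      by (simp add: algebra_simps)
    then show "?l ((1 - t) *\<^sub>R r + t *\<^sub>R s) \<le> (1 - t) * ?l r + t * ?l s"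
      using convex_onD[OF assms(1), of t] t by simp
  qed simp
  moreover have "(?l has_real_derivative (grad h x \<bullet> (y - x))) (at 0)"
    using GDERIV_along_line[of h x 0 "y - x"] assms(2) by simp
  ultimately have "?l 1 - ?l 0 \<ge> (grad h x \<bullet> (y - x)) * (1 - 0)"
    by (intro convex_on_imp_above_tangent[of UNIV]) auto
  then show ?thesis by simp
qed

text \<open>The descent lemma for a dual pair of norms: along the segment, Hoelder's inequality and
  the Lipschitz bound control the growth of the directional derivative.\<close>

lemma lr_smooth_upper_bound:
  fixes h :: "real^'d \<Rightarrow> real"
  assumes pq: "1 \<le> p" "1 \<le> q" "1 / p + 1 / q = 1"
    and diff: "\<And>x. h differentiable (at x)"
    and lip: "\<And>x y. lr_norm p (grad h x - grad h y) \<le> L * lr_norm q (x - y)"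
  shows "h (x + v) \<le> h x + grad h x \<bullet> v + L / 2 * (lr_norm q v)\<^sup>2"
proof -
  \<comment> \<open>Up to the constant \<open>h x\<close>, this is the error of the quadratic model
    along the segment; the claim is \<open>\<phi> 1 \<le> \<phi> 0\<close>, so a nonpositive
    derivative suffices.\<close>
  define \<phi> where "\<phi> t = h (x + t *\<^sub>R v) - t * (grad h x \<bullet> v) - L / 2 * (lr_norm q v)\<^sup>2 * t\<^sup>2" for t
  define \<phi>' where "\<phi>' t = (grad h (x + t *\<^sub>R v) - grad h x) \<bullet> v - L * (lr_norm q v)\<^sup>2 * t" for t
  have "\<phi> 1 \<le> \<phi> 0"
  proof (rule DERIV_nonpos_imp_nonincreasing[of 0 1])
    fix t :: real assume t: "0 \<le> t" "t \<le> 1"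
    have "(\<phi> has_real_derivative \<phi>' t) (at t)"
      unfolding \<phi>_def \<phi>'_def
      by (rule derivative_eq_intros GDERIV_along_line diff refl)+ (simp add: inner_diff_left)
    moreover have "\<phi>' t \<le> 0"
    proof -
      have "(grad h (x + t *\<^sub>R v) - grad h x) \<bullet> v
          \<le> lr_norm p (grad h (x + t *\<^sub>R v) - grad h x) * lr_norm q v"
        by (rule inner_le_lr_norm[OF pq])
      also have "\<dots> \<le> L * lr_norm q (t *\<^sub>R v) * lr_norm q v"
        using lip[of "x + t *\<^sub>R v" x] by (intro mult_right_mono) auto
      finally show ?thesis
        using t by (simp add: \<phi>'_def lr_norm_scaleR[OF pq(2)] power2_eq_square mult_ac)
    qed
    ultimately show "\<exists>y. (\<phi> has_real_derivative y) (at t) \<and> y \<le> 0" by blast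
  qed simp
  then show ?thesis by (simp add: \<phi>_def)
qed

text \<open>A gradient step along a dual vector of the gradient decreases the function by
  \<open>\<parallel>\<nabla>h\<parallel>\<^sup>2 / 2L\<close>.\<close>

lemma lr_smooth_gradient_bound:
  fixes h :: "real^'d \<Rightarrow> real"
  assumes pq: "1 \<le> p" "1 \<le> q" "1 / p + 1 / q = 1"
    and diff: "\<And>x. h differentiable (at x)" and L: "L > 0"
    and lip: "\<And>x y. lr_norm p (grad h x - grad h y) \<le> L * lr_norm q (x - y)"
    and min: "\<And>x. m \<le> h x"
  shows "(lr_norm p (grad h x))\<^sup>2 \<le> 2 * L * (h x - m)"
proof -
  define N where "N = lr_norm p (grad h x)"
  obtain u where u: "lr_norm q u \<le> 1" "grad h x \<bullet> u = N"
    using lr_norm_dual_attained[OF pq, of "grad h x"] unfolding N_def by metis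
  \<comment> \<open>The length \<open>N / L\<close> minimizes the model
    \<open>- t * N + L / 2 * t^2\<close> in \<open>t\<close>.\<close>
  have "m \<le> h (x + (- (N / L)) *\<^sub>R u)" by (rule min)
  also have "\<dots> \<le> h x + grad h x \<bullet> ((- (N / L)) *\<^sub>R u) + L / 2 * (lr_norm q ((- (N / L)) *\<^sub>R u))\<^sup>2"
    by (rule lr_smooth_upper_bound[OF pq diff lip])
  also have "\<dots> = h x - N\<^sup>2 / L + N\<^sup>2 / (2 * L) * (lr_norm q u)\<^sup>2"
    unfolding lr_norm_scaleR[OF pq(2)] inner_scaleR_right u(2)
    using L by (simp add: power2_eq_square field_simps)
  also have "\<dots> \<le> h x - N\<^sup>2 / L + N\<^sup>2 / (2 * L) * 1"
    using u(1) L by (intro add_left_mono mult_left_mono power_le_one) auto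
  finally show ?thesis using L by (simp add: N_def field_simps)
qed

context
  fixes f :: "nat \<Rightarrow> 'a::euclidean_space \<Rightarrow> real" and n :: nat and x :: 'a
  assumes diff: "\<And>i. i \<in> {1..n} \<Longrightarrow> f i differentiable (at x)"
begin

lemma GDERIV_avg_fun: "GDERIV (avg_fun f n) x :> (\<Sum>i = 1..n. grad (f i) x) /\<^sub>R real n"
proof -
  have "((\<lambda>x. (\<Sum>i = 1..n. f i x) / real n) has_derivative
      (\<lambda>h. (\<Sum>i = 1..n. h \<bullet> grad (f i) x) / real n)) (at x)"
    using GDERIV_grad[OF diff] unfolding gderiv_def
    by (intro bounded_linear.has_derivative[OF bounded_linear_divide] has_derivative_sum)
  then show ?thesis
    unfolding gderiv_def avg_fun_def
    by (rule has_derivative_eq_rhs) (auto simp: inner_sum_right divide_inverse_commute)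
qed

lemma differentiable_avg_fun: "avg_fun f n differentiable (at x)"
  using GDERIV_avg_fun unfolding gderiv_def differentiable_def by blast

lemma grad_avg_fun: "grad (avg_fun f n) x = (\<Sum>i = 1..n. grad (f i) x) /\<^sub>R real n"
  by (rule grad_eqI[OF GDERIV_avg_fun])

end

text \<open>Averaging preserves the constant \<open>L\<close> by the triangle inequality, so the
  smoothness bounds apply to the objective itself.\<close>

lemma lr_lipschitz_grad_avg_fun:
  fixes f :: "nat \<Rightarrow> real^'d \<Rightarrow> real"
  assumes pq: "1 \<le> p" "1 \<le> q" "1 / p + 1 / q = 1" and n: "n \<ge> 1"
    and diff: "\<And>i x. i \<in> {1..n} \<Longrightarrow> f i differentiable (at x)"
    and lip: "\<And>i x y. i \<in> {1..n} \<Longrightarrow>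
           lr_norm p (grad (f i) x - grad (f i) y) \<le> L * lr_norm q (x - y)"
  shows "lr_norm p (grad (avg_fun f n) x - grad (avg_fun f n) y) \<le> L * lr_norm q (x - y)"
proof -
  have avg: "grad (avg_fun f n) z = (\<Sum>i = 1..n. grad (f i) z) /\<^sub>R real n" for z
    by (rule grad_avg_fun) (rule diff)
  have "grad (avg_fun f n) x - grad (avg_fun f n) y
      = (1 / real n) *\<^sub>R (\<Sum>i = 1..n. grad (f i) x - grad (f i) y)"
    by (simp add: avg sum_subtractf scaleR_diff_right divide_inverse)
  also have "lr_norm p \<dots> = (1 / real n) * lr_norm p (\<Sum>i = 1..n. grad (f i) x - grad (f i) y)"
    by (subst lr_norm_scaleR[OF pq(1)]) simp
  also have "\<dots> \<le> (1 / real n) * (\<Sum>i = 1..n. lr_norm p (grad (f i) x - grad (f i) y))"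
    by (intro mult_left_mono lr_norm_sum[OF pq]) auto
  also have "\<dots> \<le> (1 / real n) * (\<Sum>i = 1..n. L * lr_norm q (x - y))"
    by (intro mult_left_mono sum_mono lip) auto
  finally show ?thesis using n by simp
qed

section \<open>Uniform noise on the cube\<close>

lemma sample_box_eq_cbox: "{u :: real^'d. \<forall>i. u $ i \<in> {-1..1}} = cbox (-1) 1"
  by (auto simp: mem_box_cart)

lemma emeasure_sample_box:
  "emeasure lborel (cbox (-1) 1 :: (real^'d) set) = ennreal (2 ^ CARD('d))"
proof -
  have "emeasure lborel (cbox (-1) 1 :: (real^'d) set)
      = ennreal (measure lborel (cbox (-1) 1 :: (real^'d) set))"
    by (rule emeasure_eq_ennreal_measure) (simp add: emeasure_lborel_cbox_eq)
  also have "measure lborel (cbox (-1) 1 :: (real^'d) set) = 2 ^ CARD('d)"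
    by (subst content_cbox_cart) (auto simp: interval_ne_empty_cart)
  finally show ?thesis by simp
qed

lemma prob_space_uniform_sample_box:
  "prob_space (uniform_measure lborel (cbox (-1) 1 :: (real^'d) set))"
  by (rule prob_space_uniform_measure) (auto simp: emeasure_sample_box)

text \<open>The slab inside the cube is again a box, with side \<open>b - a\<close> in direction
  \<open>j\<close> and side 2 in all others.\<close>

lemma measure_slab_sample_box:
  fixes j :: "'d::finite"
  assumes ab: "-1 \<le> a" "a \<le> b" "b \<le> 1"
  shows "measure lborel ({u. a \<le> u $ j \<and> u $ j \<le> b} \<inter> cbox (-1) 1 :: (real^'d) set)
      = (b - a) * 2 ^ (CARD('d) - 1)"
proof -
  let ?l = "(\<chi> i. if i = j then a else -1) :: real^'d" and ?u = "(\<chi> i. if i = j then b else 1) :: real^'d"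
  have "{u. a \<le> u $ j \<and> u $ j \<le> b} \<inter> cbox (-1) 1 = cbox ?l ?u"
  proof (intro set_eqI iffI)
    fix u assume "u \<in> cbox ?l ?u"
    then have u: "(if i = j then a else -1) \<le> u $ i \<and> u $ i \<le> (if i = j then b else 1)" for i
      by (auto simp: mem_box_cart)
    have "-1 \<le> u $ i \<and> u $ i \<le> 1" for i
      using u[of i] ab by (cases "i = j") auto
    then show "u \<in> {u. a \<le> u $ j \<and> u $ j \<le> b} \<inter> cbox (-1) 1"
      using u[of j] by (simp add: mem_box_cart)
  qed (auto simp: mem_box_cart)
  also have "measure lborel (cbox ?l ?u) = (\<Prod>i\<in>UNIV. ?u $ i - ?l $ i)"
    using ab by (intro content_cbox_cart) (auto simp: interval_ne_empty_cart)
  also have "\<dots> = (\<Prod>i\<in>UNIV. if i = j then b - a else 2)"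
    by (rule prod.cong) auto
  also have "\<dots> = (b - a) * (\<Prod>i\<in>UNIV - {j}. if i = j then b - a else 2)"
    by (subst prod.remove[of UNIV j]) auto
  also have "(\<Prod>i\<in>UNIV - {j}. if i = j then b - a else 2) = (\<Prod>i\<in>UNIV - {j}. (2::real))"
    by (rule prod.cong) auto
  finally show ?thesis by simp
qed

text \<open>The mean is the probability of \<open>u $ j \<ge> c\<close> minus that of
  \<open>u $ j \<le> c\<close>, that is \<open>(1 - c) / 2 - (c + 1) / 2\<close>.\<close>

lemma integral_sgn_uniform_sample_box:
  fixes j :: "'d::finite"
  assumes c: "\<bar>c\<bar> \<le> 1"
  shows "(\<integral>u. sgn (u $ j - c) \<partial>uniform_measure lborel (cbox (-1) 1 :: (real^'d) set)) = - c"
proof -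
  let ?B = "cbox (-1) 1 :: (real^'d) set" and ?\<mu> = "uniform_measure lborel (cbox (-1) 1 :: (real^'d) set)"
  interpret prob_space ?\<mu> by (rule prob_space_uniform_sample_box)
  have pow: "(2::real) ^ CARD('d) = 2 * 2 ^ (CARD('d) - 1)"
    by (metis One_nat_def Suc_pred zero_less_card_finite power_Suc)
  have prob_eq: "prob A = measure lborel (A \<inter> ?B) / 2 ^ CARD('d)" if "A \<in> sets borel" for A
    using that emeasure_sample_box[where 'd='d]
    by (subst measure_uniform_measure) (auto simp: Int_commute measure_def)
  let ?R = "{u :: real^'d. c \<le> u $ j}" and ?S = "{u :: real^'d. u $ j \<le> c}"
  have "?R \<inter> ?B = {u. c \<le> u $ j \<and> u $ j \<le> 1} \<inter> ?B"
    by (auto simp: mem_box_cart)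
  then have R: "measure lborel (?R \<inter> ?B) = (1 - c) * 2 ^ (CARD('d) - 1)"
    using measure_slab_sample_box[of c 1 j] c by simp
  have "?S \<inter> ?B = {u. -1 \<le> u $ j \<and> u $ j \<le> c} \<inter> ?B"
    by (auto simp: mem_box_cart)
  then have S: "measure lborel (?S \<inter> ?B) = (c + 1) * 2 ^ (CARD('d) - 1)"
    using measure_slab_sample_box[of "-1" c j] c by simp
  \<comment> \<open>On the overlap \<open>u $ j = c\<close> both indicators cancel, in agreement
    with \<open>sgn 0 = 0\<close>.\<close>
  have "(\<integral>u. sgn (u $ j - c) \<partial>?\<mu>) = (\<integral>u. indicator ?R u - indicator ?S u \<partial>?\<mu>)"
    by (rule Bochner_Integration.integral_cong) (auto simp: sgn_if indicator_def)
  also have "\<dots> = prob ?R - prob ?S"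
    by (subst Bochner_Integration.integral_diff) (auto intro!: integrable_const_bound[of _ 1])
  also have "\<dots> = - c"
    using R S by (simp add: prob_eq pow field_simps)
  finally show ?thesis .
qed

text \<open>Also valid for \<open>G = 0\<close>, where \<open>v = 0\<close> and \<open>v / G = 0\<close>.\<close>

lemma integral_sgn_affine_uniform_sample_box:
  fixes j :: "'d::finite"
  assumes "\<bar>v\<bar> \<le> G"
  shows "(\<integral>u. sgn (v + G * u $ j) \<partial>uniform_measure lborel (cbox (-1) 1 :: (real^'d) set)) = v / G"
proof (cases "G = 0")
  case True
  then show ?thesis using assms by simp
next
  case False
  then have G: "G > 0" using assms by linarith
  \<comment> \<open>Dividing by \<open>G > 0\<close> keeps the sign, and the threshold
    \<open>- v / G\<close> lies in \<open>[-1, 1]\<close>.\<close>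
  have "sgn (v + G * t) = sgn (t - (- v / G))" for t
    using G sgn_mult[of G "t - (- v / G)"] by (simp add: field_simps)
  then show ?thesis
    using integral_sgn_uniform_sample_box[of "- v / G" j] assms G by simp
qed

section \<open>Product laws and measurability\<close>

text \<open>A product measure is determined by its values on rectangles, where independence is
  exactly the product rule.\<close>

lemma (in prob_space) indep_pair_distr:
  assumes "indep_pair MX X MY Y"
  shows "distr M MX X \<Otimes>\<^sub>M distr M MY Y = distr M (MX \<Otimes>\<^sub>M MY) (\<lambda>\<omega>. (X \<omega>, Y \<omega>))"
proof (rule pair_measure_eqI)
  from assms have X[measurable]: "random_variable MX X" and Y[measurable]: "random_variable MY Y"
    and ind: "indep_set {X -` A \<inter> space M | A. A \<in> sets MX} {Y -` B \<inter> space M | B. B \<in> sets MY}"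
    by (auto simp: indep_pair_def)
  show "sigma_finite_measure (distr M MX X)" "sigma_finite_measure (distr M MY Y)"
    using prob_space_distr[OF X] prob_space_distr[OF Y]
    by (auto intro: prob_space_imp_sigma_finite)
  fix A B assume A: "A \<in> sets (distr M MX X)" and B: "B \<in> sets (distr M MY Y)"
  have "(\<lambda>\<omega>. (X \<omega>, Y \<omega>)) -` (A \<times> B) \<inter> space M = (X -` A \<inter> space M) \<inter> (Y -` B \<inter> space M)"
    by auto
  moreover have "prob ((X -` A \<inter> space M) \<inter> (Y -` B \<inter> space M))
      = prob (X -` A \<inter> space M) * prob (Y -` B \<inter> space M)"
    by (rule indep_setD[OF ind]) (use A B in auto)
  ultimately show "emeasure (distr M MX X) A * emeasure (distr M MY Y) B
      = emeasure (distr M (MX \<Otimes>\<^sub>M MY) (\<lambda>\<omega>. (X \<omega>, Y \<omega>))) (A \<times> B)"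
    using A B by (simp add: emeasure_distr emeasure_eq_measure ennreal_mult'')
qed simp

text \<open>Fubini's theorem as conditioning: \<open>X\<close> is frozen while \<open>Y\<close> is
  averaged out. Phrasing independence through the product law serves both past samples against the
  next one and the output index against all samples.\<close>

lemma (in prob_space) expectation_product_law:
  fixes \<phi> :: "_ \<Rightarrow> real"
  assumes [measurable]: "random_variable S X" "random_variable R Y"
    and law: "distr M S X \<Otimes>\<^sub>M distr M R Y = distr M (S \<Otimes>\<^sub>M R) (\<lambda>\<omega>. (X \<omega>, Y \<omega>))"
    and [measurable]: "\<phi> \<in> borel_measurable (S \<Otimes>\<^sub>M R)"
    and bound: "\<And>z. z \<in> space (S \<Otimes>\<^sub>M R) \<Longrightarrow> \<bar>\<phi> z\<bar> \<le> B"
  shows "integrable M (\<lambda>\<omega>. expectation (\<lambda>\<omega>'. \<phi> (X \<omega>, Y \<omega>')))"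
    and "expectation (\<lambda>\<omega>. \<phi> (X \<omega>, Y \<omega>)) = expectation (\<lambda>\<omega>. expectation (\<lambda>\<omega>'. \<phi> (X \<omega>, Y \<omega>')))"
proof -
  interpret DX: prob_space "distr M S X" by (rule prob_space_distr) fact
  interpret DY: prob_space "distr M R Y" by (rule prob_space_distr) fact
  interpret D: pair_prob_space "distr M S X" "distr M R Y" ..
  have inner: "(\<integral>y. \<phi> (x, y) \<partial>distr M R Y) = expectation (\<lambda>\<omega>'. \<phi> (x, Y \<omega>'))"
    if "x \<in> space S" for x
    using that by (intro integral_distr) auto
  have m[measurable]: "(\<lambda>x. \<integral>y. \<phi> (x, y) \<partial>distr M R Y) \<in> borel_measurable S"
    by measurable
  have int: "integrable (distr M S X \<Otimes>\<^sub>M distr M R Y) \<phi>"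
    using bound by (intro D.P.integrable_const_bound[of _ B]) (auto simp: space_pair_measure)
  have eq: "(\<integral>y. \<phi> (X \<omega>, y) \<partial>distr M R Y) = expectation (\<lambda>\<omega>'. \<phi> (X \<omega>, Y \<omega>'))"
    if "\<omega> \<in> space M" for \<omega>
    using that by (intro inner measurable_space[OF assms(1)])
  have "integrable (distr M S X) (\<lambda>x. \<integral>y. \<phi> (x, y) \<partial>distr M R Y)"
    using D.integrable_fst'[OF int] by simp
  then have "integrable M (\<lambda>\<omega>. \<integral>y. \<phi> (X \<omega>, y) \<partial>distr M R Y)"
    by (subst (asm) integrable_distr_eq) auto
  then show "integrable M (\<lambda>\<omega>. expectation (\<lambda>\<omega>'. \<phi> (X \<omega>, Y \<omega>')))"
    by (rule Bochner_Integration.integrable_cong[THEN iffD1, rotated 2]) (auto simp: eq)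
  have "expectation (\<lambda>\<omega>. \<phi> (X \<omega>, Y \<omega>)) = integral\<^sup>L (distr M (S \<Otimes>\<^sub>M R) (\<lambda>\<omega>. (X \<omega>, Y \<omega>))) \<phi>"
    by (subst integral_distr) auto
  also have "\<dots> = (\<integral>x. (\<integral>y. \<phi> (x, y) \<partial>distr M R Y) \<partial>distr M S X)"
    using D.integral_fst'[OF int] by (simp add: law)
  also have "\<dots> = expectation (\<lambda>\<omega>. \<integral>y. \<phi> (X \<omega>, y) \<partial>distr M R Y)"
    by (subst integral_distr) auto
  also have "\<dots> = expectation (\<lambda>\<omega>. expectation (\<lambda>\<omega>'. \<phi> (X \<omega>, Y \<omega>')))"
    by (rule Bochner_Integration.integral_cong) (auto simp: eq)
  finally show "expectation (\<lambda>\<omega>. \<phi> (X \<omega>, Y \<omega>)) = \<dots>" .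
qed

section \<open>The law of one sample (index and noise), and measurability of the vector
  operations\<close>

abbreviation sample_measure :: "nat \<Rightarrow> (nat \<times> (real^'d)) measure" where
  "sample_measure n \<equiv> uniform_count_measure {1..n} \<Otimes>\<^sub>M uniform_measure lborel (cbox (-1) 1)"

lemma prob_space_sample_measure:
  fixes n :: nat
  assumes "n \<ge> 1"
  shows "pair_prob_space (uniform_count_measure {1..n}) (uniform_measure lborel (cbox (-1) 1 :: (real^'d) set))"
proof -
  interpret A: prob_space "uniform_count_measure {1..n}"
    using assms by (intro prob_space_uniform_count_measure) auto
  interpret B: prob_space "uniform_measure lborel (cbox (-1) 1 :: (real^'d) set)"
    by (rule prob_space_uniform_sample_box)
  show ?thesis ..
qed

lemma borel_measurable_vec_nth [measurable (raw)]:
  fixes g :: "'a \<Rightarrow> real^'d"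
  assumes "g \<in> borel_measurable N"
  shows "(\<lambda>x. g x $ j) \<in> borel_measurable N"
  using assms by (rule measurable_compose)
    (intro borel_measurable_continuous_onI continuous_on_component continuous_on_id)

lemma borel_measurable_vec_lambda [measurable (raw)]:
  fixes g :: "'a \<Rightarrow> 'd::finite \<Rightarrow> real"
  assumes "\<And>j. (\<lambda>x. g x j) \<in> borel_measurable N"
  shows "(\<lambda>x. \<chi> j. g x j) \<in> borel_measurable N"
proof (rule borel_measurable_euclidean_space[THEN iffD2], rule ballI)
  fix b :: "real^'d" assume "b \<in> Basis"
  then obtain j where "b = axis j 1" by (auto simp: Basis_vec_def)
  then show "(\<lambda>x. (\<chi> j. g x j) \<bullet> b) \<in> borel_measurable N"
    using assms[of j] by (simp add: inner_axis)
qed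

lemma borel_measurable_sign_vec [measurable]: "sign_vec \<in> borel_measurable borel"
  unfolding sign_vec_def by measurable

lemma borel_measurable_lr_norm [measurable]: "lr_norm r \<in> borel_measurable borel"
proof (cases "r = \<infinity>")
  case True
  have "(infnorm :: real^'d \<Rightarrow> real) \<in> borel_measurable borel"
    by (intro borel_measurable_continuous_onI continuous_on_infnorm continuous_on_id)
  then show ?thesis using True by (simp add: lr_norm_def[abs_def])
qed (simp add: lr_norm_def[abs_def])

text \<open>Transfers measurability between the space in which the samples take values and their
  law.\<close>

lemma sets_sample_measure: "sets (sample_measure n) = sets (count_space {1..n} \<Otimes>\<^sub>M borel)"
  by (rule sets_pair_measure_cong) (simp_all add: uniform_count_measure_def sets_point_measure)

text \<open>By Fubini the noise is integrated first, giving \<open>v i $ j / G\<close> for each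
  fixed index, and these values are then averaged over the index.\<close>

lemma integral_sgn_sample_measure:
  fixes v :: "nat \<Rightarrow> real^'d" and j :: "'d::finite"
  assumes n: "n \<ge> 1" and v: "\<And>i. i \<in> {1..n} \<Longrightarrow> \<bar>v i $ j\<bar> \<le> G"
  shows "integrable (sample_measure n) (\<lambda>z. sgn (v (fst z) $ j + G * snd z $ j))"
    and "(\<integral>z. sgn (v (fst z) $ j + G * snd z $ j) \<partial>sample_measure n)
      = (\<Sum>i = 1..n. v i $ j) / real n / G"
proof -
  interpret pair_prob_space "uniform_count_measure {1..n}" "uniform_measure lborel (cbox (-1) 1 :: (real^'d) set)"
    by (rule prob_space_sample_measure[OF n])
  have v_meas[measurable]: "(\<lambda>z. v (fst z) $ j) \<in> borel_measurable (count_space {1..n} \<Otimes>\<^sub>M borel)"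
    by (rule measurable_compose[OF measurable_fst]) simp
  have "(\<lambda>z. sgn (v (fst z) $ j + G * snd z $ j)) \<in> borel_measurable (count_space {1..n} \<Otimes>\<^sub>M borel)"
    by measurable
  then have meas: "(\<lambda>z. sgn (v (fst z) $ j + G * snd z $ j)) \<in> borel_measurable (sample_measure n)"
    by (subst measurable_cong_sets[OF sets_sample_measure refl])
  show int: "integrable (sample_measure n) (\<lambda>z. sgn (v (fst z) $ j + G * snd z $ j))"
    using meas by (intro P.integrable_const_bound[of _ 1]) (auto simp: sgn_if)
  have "(\<integral>z. sgn (v (fst z) $ j + G * snd z $ j) \<partial>sample_measure n)
      = (\<integral>i. (\<integral>u. sgn (v i $ j + G * u $ j) \<partial>uniform_measure lborel (cbox (-1) 1)) \<partial>uniform_count_measure {1..n})"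
    using integral_fst'[OF int] by simp
  also have "\<dots> = (\<Sum>i = 1..n. \<integral>u. sgn (v i $ j + G * u $ j) \<partial>uniform_measure lborel (cbox (-1) 1)) / real n"
    by (subst integral_uniform_count_measure) auto
  also have "(\<Sum>i = 1..n. \<integral>u. sgn (v i $ j + G * u $ j) \<partial>uniform_measure lborel (cbox (-1) 1))
      = (\<Sum>i = 1..n. v i $ j / G)"
    by (intro sum.cong refl integral_sgn_affine_uniform_sample_box v)
  also have "\<dots> / real n = (\<Sum>i = 1..n. v i $ j) / real n / G"
    by (simp only: sum_divide_distrib[symmetric] divide_divide_eq_left mult.commute)
  finally show "(\<integral>z. sgn (v (fst z) $ j + G * snd z $ j) \<partial>sample_measure n)
      = (\<Sum>i = 1..n. v i $ j) / real n / G" .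
qed

section \<open>One step of the algorithm\<close>

lemma norm_sign_vec: "(norm (sign_vec (v :: real^'d)))\<^sup>2 \<le> real CARD('d)"
proof -
  have "(norm (sign_vec v))\<^sup>2 = (\<Sum>j\<in>UNIV. (sgn (v $ j))\<^sup>2)"
    unfolding power2_norm_eq_inner inner_vec_def sign_vec_def by (simp add: power2_eq_square)
  also have "\<dots> \<le> (\<Sum>j\<in>(UNIV::'d set). 1)"
    by (intro sum_mono) (auto simp: sgn_if)
  finally show ?thesis by simp
qed

lemma norm_diff_scaleR_square:
  fixes x y :: "'a::real_inner"
  shows "(norm (x - c *\<^sub>R y))\<^sup>2 = (norm x)\<^sup>2 - 2 * c * (x \<bullet> y) + c\<^sup>2 * (norm y)\<^sup>2"
  unfolding power2_norm_eq_inner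
  by (simp add: inner_diff_left inner_diff_right inner_commute power2_eq_square algebra_simps)

text \<open>The right-hand side is the tangent at \<open>s = m\<close> of the convex function on the left.\<close>

lemma square_over_affine_tangent:
  fixes s m :: real
  assumes "s \<ge> 0" "m > 0"
  shows "s\<^sup>2 / (m + s) \<ge> (3 * s - m) / 4"
proof -
  \<comment> \<open>The difference \<open>4 * s^2 - (3 * s - m) * (m + s)\<close> equals this
    square.\<close>
  have "0 \<le> (s - m)\<^sup>2" by simp
  then have "(3 * s - m) * (m + s) \<le> 4 * s\<^sup>2"
    by (simp add: power2_eq_square algebra_simps)
  then show ?thesis using assms by (simp add: field_simps)
qed

text \<open>Only the objective is fixed here; the random samples enter with
  \<open>signsvrg_run\<close>.\<close>

locale signsvrg_problem =
  fixes f :: "nat \<Rightarrow> real^'d \<Rightarrow> real" and n :: nat and p q :: ereal and L :: real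
    and xs :: "real^'d"
  assumes n: "n \<ge> 1"
    and pq: "1 \<le> p" "1 \<le> q" "1 / p + 1 / q = 1"
    and cont_diff: "\<And>i. i \<in> {1..n} \<Longrightarrow> cont_differentiable (f i)"
    and L: "L > 0"
    and lip: "\<And>i x y. i \<in> {1..n} \<Longrightarrow>
           lr_norm p (grad (f i) x - grad (f i) y) \<le> L * lr_norm q (x - y)"
    and convex: "convex_on UNIV (avg_fun f n)"
    and minimizer: "\<And>x. avg_fun f n xs \<le> avg_fun f n x"
begin

abbreviation F :: "real^'d \<Rightarrow> real" where "F \<equiv> avg_fun f n"

definition sqrt_gap :: "real^'d \<Rightarrow> real" where
  "sqrt_gap x = sqrt (F x - F xs)"

text \<open>The invariant maintained by the reference update; the one-step analysis holds for every
  state that satisfies it.\<close>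

definition valid_reference :: "real \<Rightarrow> 'd svrg_state \<Rightarrow> bool" where
  "valid_reference D s \<longleftrightarrow> ref_grad s = grad F (ref_point s) \<and>
     lr_norm q (iterate s - ref_point s) \<le> D"

text \<open>The variance-reduced gradient estimator, before noise is added.\<close>

definition direction :: "nat \<Rightarrow> 'd svrg_state \<Rightarrow> real^'d" where
  "direction i s = grad (f i) (iterate s) - grad (f i) (ref_point s) + ref_grad s"

text \<open>The scalar \<open>G\<close> of the algorithm at the given state.\<close>

definition noise_scale :: "'d svrg_state \<Rightarrow> real" where
  "noise_scale s = L * lr_norm q (iterate s - ref_point s) + lr_norm p (ref_grad s)"

lemma differentiable_component: "i \<in> {1..n} \<Longrightarrow> f i differentiable (at x)"
  using cont_diff by (auto simp: cont_differentiable_def)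

lemma differentiable_F: "F differentiable (at x)"
  by (rule differentiable_avg_fun) (rule differentiable_component)

lemma grad_F: "grad F x = (\<Sum>i = 1..n. grad (f i) x) /\<^sub>R real n"
  by (rule grad_avg_fun) (rule differentiable_component)

lemma lip_F: "lr_norm p (grad F x - grad F y) \<le> L * lr_norm q (x - y)"
  by (rule lr_lipschitz_grad_avg_fun[OF pq n differentiable_component lip])

lemma borel_measurable_grad_component:
  "i \<in> {1..n} \<Longrightarrow> grad (f i) \<in> borel_measurable borel"
  using cont_diff by (auto simp: cont_differentiable_def intro: borel_measurable_continuous_onI)

lemma borel_measurable_grad_F [measurable]: "grad F \<in> borel_measurable borel"
  unfolding grad_F[abs_def] using borel_measurable_grad_component by measurable

lemma continuous_on_F: "continuous_on S F"
  by (intro continuous_at_imp_continuous_on ballI differentiable_imp_continuous_within differentiable_F)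

lemma continuous_on_sqrt_gap: "continuous_on S sqrt_gap"
  unfolding sqrt_gap_def[abs_def] by (intro continuous_intros continuous_on_F)

lemma borel_measurable_sqrt_gap [measurable]: "sqrt_gap \<in> borel_measurable borel"
  by (intro borel_measurable_continuous_onI continuous_on_sqrt_gap)

lemma sqrt_gap_nonneg: "sqrt_gap x \<ge> 0"
  using minimizer[of x] by (simp add: sqrt_gap_def)

lemma sqrt_gap_square: "(sqrt_gap x)\<^sup>2 = F x - F xs"
  using minimizer[of x] by (simp add: sqrt_gap_def)

section \<open>Invariant, noise domination and unbiasedness for a single step\<close>

lemma iterate_signsvrg_step:
  "iterate (signsvrg_step f n p q L D \<gamma> i u s)
     = iterate s - \<gamma> *\<^sub>R sign_vec (direction i s + noise_scale s *\<^sub>R u)"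
  by (simp add: signsvrg_step_def Let_def direction_def noise_scale_def)

text \<open>The old reference is kept only if it is within \<open>D\<close> of the new iterate; a
  fresh one is at distance 0 and stores its own gradient.\<close>

lemma valid_reference_step:
  assumes "valid_reference D s" "D \<ge> 0"
  shows "valid_reference D (signsvrg_step f n p q L D \<gamma> i u s)"
  using assms pq by (auto simp: valid_reference_def signsvrg_step_def Let_def)

lemma valid_reference_state:
  assumes "D \<ge> 0"
  shows "valid_reference D (signsvrg_state f n p q L D \<gamma> I U x1 m)"
proof (induction m)
  case 0
  show ?case using assms pq by (simp add: valid_reference_def)
next
  case (Suc m)
  then show ?case using valid_reference_step assms by simp
qed

text \<open>The triangle inequality and the Lipschitz bound produce precisely the two summands of
  \<open>noise_scale\<close>, which is the condition under which the mean of the noisy sign is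
  linear.\<close>

lemma direction_le_noise_scale:
  assumes "i \<in> {1..n}"
  shows "\<bar>direction i s $ j\<bar> \<le> noise_scale s"
proof -
  have "\<bar>direction i s $ j\<bar> \<le> lr_norm p (direction i s)"
    by (rule component_le_lr_norm[OF pq(1)])
  also have "\<dots> \<le> lr_norm p (grad (f i) (iterate s) - grad (f i) (ref_point s)) + lr_norm p (ref_grad s)"
    unfolding direction_def by (rule lr_norm_triangle[OF pq])
  also have "\<dots> \<le> noise_scale s"
    unfolding noise_scale_def using lip[OF assms] by simp
  finally show ?thesis .
qed

lemma noise_scale_nonneg: "noise_scale s \<ge> 0"
  using L by (simp add: noise_scale_def)

text \<open>The subtracted gradients average to the gradient of \<open>F\<close> at the reference
  point, which the stored gradient cancels.\<close>

lemma average_direction: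
  assumes "valid_reference D s"
  shows "(\<Sum>i = 1..n. direction i s $ j) / real n = grad F (iterate s) $ j"
proof -
  have "(\<Sum>i = 1..n. direction i s $ j) / real n
      = grad F (iterate s) $ j - grad F (ref_point s) $ j + ref_grad s $ j"
    using n by (simp add: direction_def grad_F sum.distrib sum_subtractf field_simps)
  then show ?thesis using assms by (simp add: valid_reference_def)
qed

text \<open>The gradient at the reference point differs from that at the iterate by at most
  \<open>L * D\<close>, and the latter is controlled by the gap through smoothness. With the
  distance term this adds up to \<open>2 * L * D\<close>, the square of \<open>sqrt (2 * L)\<close>
  times \<open>D\<close>.\<close>

lemma noise_scale_le:
  assumes "valid_reference D s"
  shows "noise_scale s \<le> sqrt (2 * L) * (sqrt (2 * L) * D + sqrt_gap (iterate s))"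
proof -
  let ?x = "iterate s" and ?r = "ref_point s"
  have dist: "lr_norm q (?x - ?r) \<le> D" and g: "ref_grad s = grad F ?r"
    using assms by (auto simp: valid_reference_def)
  have swap: "lr_norm q (?r - ?x) = lr_norm q (?x - ?r)"
    using lr_norm_scaleR[OF pq(2), of "-1" "?x - ?r"] by simp
  have "lr_norm p (grad F ?r) \<le> lr_norm p (grad F ?r - grad F ?x) + lr_norm p (grad F ?x)"
    using lr_norm_triangle[OF pq, of "grad F ?r - grad F ?x" "grad F ?x"] by simp
  also have "\<dots> \<le> L * D + sqrt (2 * L) * sqrt_gap ?x"
  proof (rule add_mono)
    have "lr_norm p (grad F ?r - grad F ?x) \<le> L * lr_norm q (?r - ?x)" by (rule lip_F)
    also have "\<dots> \<le> L * D" using dist L by (simp add: swap)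
    finally show "lr_norm p (grad F ?r - grad F ?x) \<le> L * D" .
    have "(lr_norm p (grad F ?x))\<^sup>2 \<le> 2 * L * (F ?x - F xs)"
      by (rule lr_smooth_gradient_bound[OF pq differentiable_F L lip_F minimizer])
    then have "lr_norm p (grad F ?x) \<le> sqrt (2 * L * (F ?x - F xs))"
      by (rule real_le_rsqrt)
    then show "lr_norm p (grad F ?x) \<le> sqrt (2 * L) * sqrt_gap ?x"
      by (simp add: sqrt_gap_def real_sqrt_mult)
  qed
  moreover have "L * lr_norm q (?x - ?r) \<le> L * D" using dist L by simp
  moreover have "sqrt (2 * L) * (sqrt (2 * L) * D + sqrt_gap ?x) = 2 * (L * D) + sqrt (2 * L) * sqrt_gap ?x"
    using L by (simp add: distrib_left mult.assoc[symmetric])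
  ultimately show ?thesis by (simp add: noise_scale_def g)
qed

text \<open>Convexity bounds the inner product below by the squared \<open>sqrt_gap\<close>;
  dividing by the bound on the noise scale and taking the tangent at \<open>m\<close> makes the
  progress linear in \<open>sqrt_gap\<close>.\<close>

lemma progress_lower_bound:
  assumes valid: "valid_reference D s" and m: "sqrt (2 * L) * D \<le> m" "m > 0"
  shows "(3 * sqrt_gap (iterate s) - m) / (4 * sqrt (2 * L))
      \<le> grad F (iterate s) \<bullet> (iterate s - xs) / noise_scale s"
proof -
  let ?x = "iterate s" and ?a = "sqrt (2 * L)" and ?G = "noise_scale s"
  define r where "r = sqrt_gap ?x"
  have a: "?a > 0" using L by simp
  have r: "r \<ge> 0" by (simp add: r_def sqrt_gap_nonneg)
  have "F xs \<ge> F ?x + grad F ?x \<bullet> (xs - ?x)"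
    by (rule convex_gradient_inequality[OF convex differentiable_F])
  then have gap: "r\<^sup>2 \<le> grad F ?x \<bullet> (?x - xs)"
    unfolding r_def sqrt_gap_square by (simp add: inner_diff_right)
  show ?thesis
  proof (cases "?G = 0")
    \<comment> \<open>A zero scale forces the iterate to be its reference point with zero gradient,
      so the gap vanishes. The right-hand side is then 0 by division by zero, and the left-hand side
      is negative.\<close>
    case True
    have L0: "L * lr_norm q (?x - ref_point s) = 0" "lr_norm p (ref_grad s) = 0"
      using True L lr_norm_nonneg[of q "?x - ref_point s"] lr_norm_nonneg[of p "ref_grad s"]
      unfolding noise_scale_def by (smt (verit) mult_nonneg_nonneg)+
    have "?x = ref_point s" using L0(1) L lr_norm_eq_0[OF pq(2), of "?x - ref_point s"] by simp
    moreover have "ref_grad s = 0" by (rule lr_norm_eq_0[OF pq(1) L0(2)])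
    ultimately have "grad F ?x = 0" using valid by (simp add: valid_reference_def)
    then have "r = 0" using gap by simp
    then show ?thesis using True m a by (simp add: r_def[symmetric])
  next
    case False
    then have G: "?G > 0" using noise_scale_nonneg[of s] by simp
    have "?G \<le> ?a * (?a * D + r)" unfolding r_def by (rule noise_scale_le[OF valid])
    also have "\<dots> \<le> ?a * (m + r)" using m a by (intro mult_left_mono) auto
    finally have le: "?G \<le> ?a * (m + r)" .
    have "(3 * r - m) / (4 * ?a) = (3 * r - m) / 4 / ?a" by simp
    also have "\<dots> \<le> r\<^sup>2 / (m + r) / ?a"
      using a by (intro divide_right_mono square_over_affine_tangent r m) auto
    also have "\<dots> = r\<^sup>2 / (?a * (m + r))" by (simp add: mult.commute)
    also have "\<dots> \<le> r\<^sup>2 / ?G" using le G m r L by (intro divide_left_mono mult_pos_pos) auto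
    also have "\<dots> \<le> grad F ?x \<bullet> (?x - xs) / ?G" using gap G by (intro divide_right_mono) auto
    finally show ?thesis by (simp add: r_def)
  qed
qed

text \<open>After expanding the square, the cross term averages to a gradient step of length
  \<open>\<gamma> / G\<close> and the quadratic term costs at most \<open>\<gamma>^2\<close> times
  the dimension. Integrability is a premise here and is discharged in
  \<open>expected_descent\<close>.\<close>

lemma expected_squared_distance_step:
  assumes valid: "valid_reference D s" and \<gamma>: "\<gamma> \<ge> 0"
    and int: "integrable (sample_measure n)
      (\<lambda>z. (norm (iterate (signsvrg_step f n p q L D \<gamma> (fst z) (snd z) s) - xs))\<^sup>2)"
  shows "(\<integral>z. (norm (iterate (signsvrg_step f n p q L D \<gamma> (fst z) (snd z) s) - xs))\<^sup>2 \<partial>sample_measure n)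
    \<le> (norm (iterate s - xs))\<^sup>2 - 2 * \<gamma> * (grad F (iterate s) \<bullet> (iterate s - xs) / noise_scale s)
       + \<gamma>\<^sup>2 * real CARD('d)"
proof -
  let ?G = "noise_scale s" and ?e = "iterate s - xs"
  let ?S = "\<lambda>j z. sgn (direction (fst z) s $ j + ?G * snd z $ j)"
  interpret pair_prob_space "uniform_count_measure {1..n}" "uniform_measure lborel (cbox (-1) 1 :: (real^'d) set)"
    by (rule prob_space_sample_measure[OF n])
  have int_sgn: "integrable (sample_measure n) (?S j)" for j
    by (rule integral_sgn_sample_measure[OF n direction_le_noise_scale])
  have val_sgn: "(\<integral>z. ?S j z \<partial>sample_measure n) = grad F (iterate s) $ j / ?G" for j
    unfolding average_direction[OF valid, symmetric]
    by (rule integral_sgn_sample_measure[OF n direction_le_noise_scale])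
  \<comment> \<open>The cross term, expanded by coordinates so that the mean of each sign can be
    inserted.\<close>
  define Q where "Q z = (\<Sum>j\<in>UNIV. ?e $ j * ?S j z)" for z
  have int_Q: "integrable (sample_measure n) Q"
    unfolding Q_def by (intro Bochner_Integration.integrable_sum integrable_mult_right int_sgn)
  have "(\<integral>z. Q z \<partial>sample_measure n) = (\<Sum>j\<in>UNIV. \<integral>z. ?e $ j * ?S j z \<partial>sample_measure n)"
    unfolding Q_def by (intro Bochner_Integration.integral_sum integrable_mult_right int_sgn)
  also have "\<dots> = (\<Sum>j\<in>UNIV. ?e $ j * (\<integral>z. ?S j z \<partial>sample_measure n))"
    by simp
  also have "\<dots> = grad F (iterate s) \<bullet> ?e / ?G"
    unfolding val_sgn by (simp add: inner_vec_def sum_divide_distrib mult.commute)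
  finally have val_Q: "(\<integral>z. Q z \<partial>sample_measure n) = grad F (iterate s) \<bullet> ?e / ?G" .
  define R where "R z = (norm ?e)\<^sup>2 - 2 * \<gamma> * Q z + \<gamma>\<^sup>2 * real CARD('d)" for z
  have "(\<integral>z. (norm (iterate (signsvrg_step f n p q L D \<gamma> (fst z) (snd z) s) - xs))\<^sup>2 \<partial>sample_measure n)
      \<le> (\<integral>z. R z \<partial>sample_measure n)"
  proof (rule integral_mono[OF int])
    show "integrable (sample_measure n) R"
      unfolding R_def using int_Q by (simp del: One_nat_def)
    fix z
    let ?v = "sign_vec (direction (fst z) s + ?G *\<^sub>R snd z)"
    have "(norm (iterate (signsvrg_step f n p q L D \<gamma> (fst z) (snd z) s) - xs))\<^sup>2
        = (norm (?e - \<gamma> *\<^sub>R ?v))\<^sup>2"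
      by (simp add: iterate_signsvrg_step algebra_simps)
    also have "\<dots> = (norm ?e)\<^sup>2 - 2 * \<gamma> * (?e \<bullet> ?v) + \<gamma>\<^sup>2 * (norm ?v)\<^sup>2"
      by (rule norm_diff_scaleR_square)
    also have "\<dots> \<le> (norm ?e)\<^sup>2 - 2 * \<gamma> * (?e \<bullet> ?v) + \<gamma>\<^sup>2 * real CARD('d)"
      by (intro add_left_mono mult_left_mono norm_sign_vec) auto
    also have "\<dots> = R z"
      by (simp add: R_def Q_def inner_vec_def sign_vec_def)
    finally show "(norm (iterate (signsvrg_step f n p q L D \<gamma> (fst z) (snd z) s) - xs))\<^sup>2 \<le> R z" .
  qed
  also have "\<dots> = (norm ?e)\<^sup>2 - 2 * \<gamma> * (grad F (iterate s) \<bullet> ?e / ?G) + \<gamma>\<^sup>2 * real CARD('d)"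
    unfolding R_def val_Q[symmetric] using int_Q by (simp add: P.prob_space del: One_nat_def)
  finally show ?thesis .
qed

end

section \<open>Descent along the run\<close>

context signsvrg_problem
begin

text \<open>Expressed through the new iterate, so that measurability of the reference data follows
  from that of the iterate.\<close>

lemma ref_point_signsvrg_step:
  "ref_point (signsvrg_step f n p q L D \<gamma> i u s) =
     (let x' = iterate (signsvrg_step f n p q L D \<gamma> i u s)
      in if lr_norm q (x' - ref_point s) \<le> D then ref_point s else x')"
  and ref_grad_signsvrg_step:
  "ref_grad (signsvrg_step f n p q L D \<gamma> i u s) =
     (let x' = iterate (signsvrg_step f n p q L D \<gamma> i u s)
      in if lr_norm q (x' - ref_point s) \<le> D then ref_grad s else grad F x')"
  by (simp_all add: signsvrg_step_def Let_def)

text \<open>No sigma-algebra is put on the state record, so measurability is tracked field by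
  field.\<close>

lemma borel_measurable_signsvrg_step:
  assumes i: "i \<in> measurable N (count_space {1..n})" and [measurable]: "u \<in> borel_measurable N"
    and s[measurable]: "(\<lambda>\<omega>. iterate (s \<omega>)) \<in> borel_measurable N"
      "(\<lambda>\<omega>. ref_point (s \<omega>)) \<in> borel_measurable N" "(\<lambda>\<omega>. ref_grad (s \<omega>)) \<in> borel_measurable N"
  shows "(\<lambda>\<omega>. iterate (signsvrg_step f n p q L D \<gamma> (i \<omega>) (u \<omega>) (s \<omega>))) \<in> borel_measurable N"
    and "(\<lambda>\<omega>. ref_point (signsvrg_step f n p q L D \<gamma> (i \<omega>) (u \<omega>) (s \<omega>))) \<in> borel_measurable N"
    and "(\<lambda>\<omega>. ref_grad (signsvrg_step f n p q L D \<gamma> (i \<omega>) (u \<omega>) (s \<omega>))) \<in> borel_measurable N"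
proof -
  \<comment> \<open>The function itself is random here, but the index has countable range, so
    measurability for each fixed index suffices.\<close>
  have grad: "(\<lambda>\<omega>. grad (f (i \<omega>)) (y \<omega>)) \<in> borel_measurable N" if "y \<in> borel_measurable N" for y
    by (rule measurable_compose_countable'[OF measurable_compose[OF that borel_measurable_grad_component] i]) auto
  note grad[OF s(1), measurable] grad[OF s(2), measurable]
  show x[measurable]:
    "(\<lambda>\<omega>. iterate (signsvrg_step f n p q L D \<gamma> (i \<omega>) (u \<omega>) (s \<omega>))) \<in> borel_measurable N"
    unfolding iterate_signsvrg_step direction_def noise_scale_def by measurable
  show "(\<lambda>\<omega>. ref_point (signsvrg_step f n p q L D \<gamma> (i \<omega>) (u \<omega>) (s \<omega>))) \<in> borel_measurable N"
    unfolding ref_point_signsvrg_step Let_def by measurable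
  show "(\<lambda>\<omega>. ref_grad (signsvrg_step f n p q L D \<gamma> (i \<omega>) (u \<omega>) (s \<omega>))) \<in> borel_measurable N"
    unfolding ref_grad_signsvrg_step Let_def by measurable
qed

lemma borel_measurable_signsvrg_state:
  assumes "\<And>t. t \<in> {1..m} \<Longrightarrow> (\<lambda>\<omega>. I \<omega> t) \<in> measurable N (count_space {1..n})"
    and "\<And>t. t \<in> {1..m} \<Longrightarrow> (\<lambda>\<omega>. U \<omega> t) \<in> borel_measurable N"
  shows "(\<lambda>\<omega>. iterate (signsvrg_state f n p q L D \<gamma> (I \<omega>) (U \<omega>) x1 m)) \<in> borel_measurable N \<and>
    (\<lambda>\<omega>. ref_point (signsvrg_state f n p q L D \<gamma> (I \<omega>) (U \<omega>) x1 m)) \<in> borel_measurable N \<and>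
    (\<lambda>\<omega>. ref_grad (signsvrg_state f n p q L D \<gamma> (I \<omega>) (U \<omega>) x1 m)) \<in> borel_measurable N"
  using assms
proof (induction m)
  case (Suc m)
  then show ?case
    unfolding signsvrg_state.simps by (intro conjI borel_measurable_signsvrg_step) auto
qed simp

text \<open>This adaptedness makes the state after \<open>m\<close> steps a function of the first
  \<open>m\<close> samples, hence independent of the next one in a random run.\<close>

lemma signsvrg_state_cong:
  assumes "\<And>t. t \<in> {1..m} \<Longrightarrow> I t = I' t" "\<And>t. t \<in> {1..m} \<Longrightarrow> U t = U' t"
  shows "signsvrg_state f n p q L D \<gamma> I U x1 m = signsvrg_state f n p q L D \<gamma> I' U' x1 m"
  using assms by (induction m) auto

lemma norm_iterate_signsvrg_step:
  assumes "\<gamma> \<ge> 0"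
  shows "norm (iterate (signsvrg_step f n p q L D \<gamma> i u s) - xs)
    \<le> norm (iterate s - xs) + \<gamma> * sqrt (real CARD('d))"
proof -
  let ?v = "sign_vec (direction i s + noise_scale s *\<^sub>R u)"
  have "norm (iterate (signsvrg_step f n p q L D \<gamma> i u s) - xs) = norm (iterate s - xs - \<gamma> *\<^sub>R ?v)"
    by (simp add: iterate_signsvrg_step algebra_simps)
  also have "\<dots> \<le> norm (iterate s - xs) + norm (\<gamma> *\<^sub>R ?v)" by (rule norm_triangle_ineq4)
  also have "norm (\<gamma> *\<^sub>R ?v) \<le> \<gamma> * sqrt (real CARD('d))"
    using assms norm_sign_vec[of "direction i s + noise_scale s *\<^sub>R u"]
    by (simp add: mult_left_mono real_le_rsqrt)
  finally show ?thesis by simp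
qed

text \<open>Each step moves by at most \<open>\<gamma> * sqrt d\<close>, where \<open>d\<close> is
  the dimension. The bound is uniform over sample paths, so integrability reduces to
  measurability.\<close>

lemma norm_iterate_signsvrg_state:
  assumes "\<gamma> \<ge> 0"
  shows "norm (iterate (signsvrg_state f n p q L D \<gamma> I U x1 m) - xs)
    \<le> norm (x1 - xs) + real m * (\<gamma> * sqrt (real CARD('d)))"
proof (induction m)
  case (Suc m)
  then show ?case
    using norm_iterate_signsvrg_step[OF assms, of D "I (Suc m)" "U (Suc m)"
        "signsvrg_state f n p q L D \<gamma> I U x1 m"]
    by (simp add: distrib_right)
qed simp

text \<open>A continuous function on a compact ball; together with the bound on the iterates it
  makes the gap bounded along a run.\<close>

lemma sqrt_gap_bounded_on_cball:
  obtains B where "\<And>x. norm (x - xs) \<le> R \<Longrightarrow> sqrt_gap x \<le> B"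
proof -
  have "bounded (sqrt_gap ` cball xs R)"
    by (intro compact_imp_bounded compact_continuous_image continuous_on_sqrt_gap) simp
  then obtain B where B: "\<forall>y \<in> sqrt_gap ` cball xs R. norm y \<le> B"
    unfolding bounded_iff by blast
  show thesis
  proof (rule that)
    fix x assume "norm (x - xs) \<le> R"
    then have "norm (sqrt_gap x) \<le> B" using B by (simp add: dist_norm norm_minus_commute)
    then show "sqrt_gap x \<le> B" by simp
  qed
qed

end

text \<open>The output index joins only in \<open>expectation_sqrt_gap_uniform_index\<close>, since
  the descent is proved at fixed times.\<close>

locale signsvrg_run = signsvrg_problem f n p q L xs + prob_space M
  for f :: "nat \<Rightarrow> real^'d \<Rightarrow> real" and n p q L xs and M :: "'w measure" +
  fixes I :: "nat \<Rightarrow> 'w \<Rightarrow> nat" and U :: "nat \<Rightarrow> 'w \<Rightarrow> real^'d" and T :: nat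
    and x1 :: "real^'d" and \<gamma> D :: real
  assumes \<gamma>: "\<gamma> \<ge> 0" and D: "D \<ge> 0"
    and I_uniform: "\<And>t. t \<in> {1..T} \<Longrightarrow>
      distr M (count_space {1..n}) (I t) = uniform_count_measure {1..n}"
    and U_uniform: "\<And>t. t \<in> {1..T} \<Longrightarrow> distr M borel (U t) = uniform_measure lborel (cbox (-1) 1)"
    and indep_I_U: "\<And>t. t \<in> {1..T} \<Longrightarrow> indep_pair (count_space {1..n}) (I t) borel (U t)"
    and indep_samples: "indep_vars (\<lambda>t. count_space {1..n} \<Otimes>\<^sub>M borel) (\<lambda>t \<omega>. (I t \<omega>, U t \<omega>)) {1..T}"
begin

definition run_state :: "nat \<Rightarrow> 'w \<Rightarrow> 'd svrg_state" where
  "run_state m \<omega> = signsvrg_state f n p q L D \<gamma> (\<lambda>t. I t \<omega>) (\<lambda>t. U t \<omega>) x1 m"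

text \<open>The state as a function of the sample sequence rather than of the outcome, as
  integration against a product law requires.\<close>

definition history_state :: "nat \<Rightarrow> (nat \<Rightarrow> nat \<times> (real^'d)) \<Rightarrow> 'd svrg_state" where
  "history_state m h = signsvrg_state f n p q L D \<gamma> (\<lambda>t. fst (h t)) (\<lambda>t. snd (h t)) x1 m"

abbreviation sample_space :: "(nat \<times> (real^'d)) measure" where
  "sample_space \<equiv> count_space {1..n} \<Otimes>\<^sub>M borel"

lemma random_variable_I: "t \<in> {1..T} \<Longrightarrow> random_variable (count_space {1..n}) (I t)"
  and random_variable_U: "t \<in> {1..T} \<Longrightarrow> random_variable borel (U t)"
  using indep_I_U by (auto simp: indep_pair_def)

lemma sample_law:
  assumes "t \<in> {1..T}"
  shows "distr M sample_space (\<lambda>\<omega>. (I t \<omega>, U t \<omega>)) = sample_measure n"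
  unfolding indep_pair_distr[OF indep_I_U[OF assms], symmetric] I_uniform[OF assms] U_uniform[OF assms] ..

text \<open>Restriction makes samples outside \<open>A\<close> undefined, but only those in
  \<open>{1..m}\<close> are read.\<close>

lemma history_state_restrict:
  "{1..m} \<subseteq> A \<Longrightarrow> history_state m (\<lambda>t\<in>A. (I t \<omega>, U t \<omega>)) = run_state m \<omega>"
  unfolding history_state_def run_state_def by (rule signsvrg_state_cong) auto

lemma borel_measurable_history_state:
  assumes "{1..m} \<subseteq> A" and [measurable]: "g \<in> measurable N (\<Pi>\<^sub>M t\<in>A. sample_space)"
  shows "(\<lambda>w. iterate (history_state m (g w))) \<in> borel_measurable N"
    and "(\<lambda>w. ref_point (history_state m (g w))) \<in> borel_measurable N"
    and "(\<lambda>w. ref_grad (history_state m (g w))) \<in> borel_measurable N"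
proof -
  have g: "(\<lambda>w. g w t) \<in> measurable N sample_space" if "t \<in> {1..m}" for t
    using that assms(1) by (intro measurable_compose[OF assms(2) measurable_component_singleton]) auto
  have "(\<lambda>w. fst (g w t)) \<in> measurable N (count_space {1..n})"
    "(\<lambda>w. snd (g w t)) \<in> borel_measurable N" if "t \<in> {1..m}" for t
    using measurable_compose[OF g[OF that] measurable_fst]
      measurable_compose[OF g[OF that] measurable_snd] by auto
  then show "(\<lambda>w. iterate (history_state m (g w))) \<in> borel_measurable N"
    "(\<lambda>w. ref_point (history_state m (g w))) \<in> borel_measurable N"
    "(\<lambda>w. ref_grad (history_state m (g w))) \<in> borel_measurable N"
    using borel_measurable_signsvrg_state[of m "\<lambda>w t. fst (g w t)" N "\<lambda>w t. snd (g w t)"]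
    unfolding history_state_def by blast+
qed

lemma borel_measurable_run_state:
  assumes "m \<le> T"
  shows "(\<lambda>\<omega>. iterate (run_state m \<omega>)) \<in> borel_measurable M"
  using assms random_variable_I random_variable_U
    borel_measurable_signsvrg_state[of m "\<lambda>\<omega> t. I t \<omega>" M "\<lambda>\<omega> t. U t \<omega>"]
  unfolding run_state_def by auto

lemma norm_run_state:
  "norm (iterate (run_state m \<omega>) - xs) \<le> norm (x1 - xs) + real m * (\<gamma> * sqrt (real CARD('d)))"
  unfolding run_state_def by (rule norm_iterate_signsvrg_state[OF \<gamma>])

lemma valid_reference_run_state: "valid_reference D (run_state m \<omega>)"
  unfolding run_state_def by (rule valid_reference_state[OF D])

lemma integrable_squared_distance:
  assumes "m \<le> T"
  shows "integrable M (\<lambda>\<omega>. (norm (iterate (run_state m \<omega>) - xs))\<^sup>2)"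
proof -
  note [measurable] = borel_measurable_run_state[OF assms]
  show ?thesis
    by (intro integrable_const_bound[of _ "(norm (x1 - xs) + real m * (\<gamma> * sqrt (real CARD('d))))\<^sup>2"])
      (auto intro!: power_mono norm_run_state)
qed

lemma integrable_sqrt_gap:
  assumes "m \<le> T"
  shows "integrable M (\<lambda>\<omega>. sqrt_gap (iterate (run_state m \<omega>)))"
proof -
  note [measurable] = borel_measurable_run_state[OF assms]
  obtain B where "\<And>x. norm (x - xs) \<le> norm (x1 - xs) + real m * (\<gamma> * sqrt (real CARD('d)))
      \<Longrightarrow> sqrt_gap x \<le> B"
    using sqrt_gap_bounded_on_cball by blast
  then show ?thesis
    using norm_run_state sqrt_gap_nonneg by (intro integrable_const_bound[of _ B]) auto
qed

text \<open>Conditioning on the first \<open>m\<close> samples freezes the current state; the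
  one-step estimate and \<open>progress_lower_bound\<close> then hold for each outcome and are
  integrated.\<close>

lemma expected_descent:
  assumes m: "m < T" and \<mu>: "sqrt (2 * L) * D \<le> \<mu>" "\<mu> > 0"
  shows "expectation (\<lambda>\<omega>. (norm (iterate (run_state (Suc m) \<omega>) - xs))\<^sup>2)
    \<le> expectation (\<lambda>\<omega>. (norm (iterate (run_state m \<omega>) - xs))\<^sup>2)
      - 2 * \<gamma> * ((3 * expectation (\<lambda>\<omega>. sqrt_gap (iterate (run_state m \<omega>))) - \<mu>) / (4 * sqrt (2 * L)))
      + \<gamma>\<^sup>2 * real CARD('d)"
proof -
  define R where "R = norm (x1 - xs) + real m * (\<gamma> * sqrt (real CARD('d))) + \<gamma> * sqrt (real CARD('d))"
  let ?S = "\<Pi>\<^sub>M t\<in>{1..m}. sample_space" and ?Q = "\<Pi>\<^sub>M t\<in>{Suc m}. sample_space"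
  \<comment> \<open>The next sample is packaged as a family over a singleton, because independence
    is obtained for families over disjoint index sets.\<close>
  let ?H = "\<lambda>\<omega>. \<lambda>t\<in>{1..m}. (I t \<omega>, U t \<omega>)" and ?Z = "\<lambda>\<omega>. \<lambda>t\<in>{Suc m}. (I t \<omega>, U t \<omega>)"
  have t: "Suc m \<in> {1..T}" using m by simp
  define next_dist where "next_dist s y =
    (norm (iterate (signsvrg_step f n p q L D \<gamma> (fst y) (snd y) s) - xs))\<^sup>2" for s and y :: "nat \<times> (real^'d)"
  define \<phi> where "\<phi> w = next_dist (history_state m (fst w)) (snd w (Suc m))"
    for w :: "(nat \<Rightarrow> nat \<times> (real^'d)) \<times> (nat \<Rightarrow> nat \<times> (real^'d))"
  have "indep_var ?S ?H ?Q ?Z"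
    using m by (intro indep_var_restrict[OF indep_samples]) auto
  then have rv: "random_variable ?S ?H" "random_variable ?Q ?Z"
    and law: "distr M ?S ?H \<Otimes>\<^sub>M distr M ?Q ?Z = distr M (?S \<Otimes>\<^sub>M ?Q) (\<lambda>\<omega>. (?H \<omega>, ?Z \<omega>))"
    unfolding indep_var_distribution_eq by auto
  have next_bound: "\<bar>next_dist s y\<bar> \<le> R\<^sup>2"
    if "norm (iterate s - xs) \<le> norm (x1 - xs) + real m * (\<gamma> * sqrt (real CARD('d)))" for s y
    unfolding next_dist_def R_def abs_power2
    using norm_iterate_signsvrg_step[OF \<gamma>, of D "fst y" "snd y" s] that
    by (intro power_mono) auto
  have bound: "\<bar>\<phi> w\<bar> \<le> R\<^sup>2" for w
    unfolding \<phi>_def history_state_def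
    by (rule next_bound[OF norm_iterate_signsvrg_state[OF \<gamma>]])
  have z: "(\<lambda>w. snd w (Suc m)) \<in> measurable (?S \<Otimes>\<^sub>M ?Q) sample_space"
    by (intro measurable_compose[OF measurable_snd measurable_component_singleton]) simp
  have [measurable]: "\<phi> \<in> borel_measurable (?S \<Otimes>\<^sub>M ?Q)"
  proof -
    have [measurable]: "(\<lambda>w. iterate (signsvrg_step f n p q L D \<gamma> (fst (snd w (Suc m))) (snd (snd w (Suc m)))
        (history_state m (fst w)))) \<in> borel_measurable (?S \<Otimes>\<^sub>M ?Q)"
      using measurable_compose[OF z measurable_fst] measurable_compose[OF z measurable_snd]
      by (intro borel_measurable_signsvrg_step(1) borel_measurable_history_state[of _ "{1..m}"]) auto
    show ?thesis unfolding \<phi>_def next_dist_def by measurable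
  qed
  have "expectation (\<lambda>\<omega>. (norm (iterate (run_state (Suc m) \<omega>) - xs))\<^sup>2)
      = expectation (\<lambda>\<omega>. \<phi> (?H \<omega>, ?Z \<omega>))"
    unfolding \<phi>_def next_dist_def fst_conv snd_conv history_state_restrict[OF order_refl]
    by (simp add: run_state_def)
  also have "\<dots> = expectation (\<lambda>\<omega>. expectation (\<lambda>\<omega>'. \<phi> (?H \<omega>, ?Z \<omega>')))"
    by (rule expectation_product_law(2)[OF rv law _ bound]) measurable
  also have "\<dots> \<le> expectation (\<lambda>\<omega>. (norm (iterate (run_state m \<omega>) - xs))\<^sup>2
      - 2 * \<gamma> * ((3 * sqrt_gap (iterate (run_state m \<omega>)) - \<mu>) / (4 * sqrt (2 * L)))
      + \<gamma>\<^sup>2 * real CARD('d))"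
  proof (rule integral_mono)
    show "integrable M (\<lambda>\<omega>. expectation (\<lambda>\<omega>'. \<phi> (?H \<omega>, ?Z \<omega>')))"
      by (rule expectation_product_law(1)[OF rv law _ bound]) measurable
    show "integrable M (\<lambda>\<omega>. (norm (iterate (run_state m \<omega>) - xs))\<^sup>2
      - 2 * \<gamma> * ((3 * sqrt_gap (iterate (run_state m \<omega>)) - \<mu>) / (4 * sqrt (2 * L)))
      + \<gamma>\<^sup>2 * real CARD('d))"
      using m integrable_squared_distance[of m] integrable_sqrt_gap[of m] by simp
    fix \<omega>
    let ?s = "run_state m \<omega>"
    have meas: "next_dist ?s \<in> borel_measurable sample_space"
    proof -
      have [measurable]: "(\<lambda>y. iterate (signsvrg_step f n p q L D \<gamma> (fst y) (snd y) ?s))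
          \<in> borel_measurable sample_space"
        by (rule borel_measurable_signsvrg_step(1)) auto
      show ?thesis unfolding next_dist_def by measurable
    qed
    have [measurable]: "random_variable sample_space (\<lambda>\<omega>'. (I (Suc m) \<omega>', U (Suc m) \<omega>'))"
      using random_variable_I[OF t] random_variable_U[OF t] by measurable
    \<comment> \<open>With the outer outcome fixed, \<open>?s\<close> is deterministic and the inner
      expectation runs over the law of a single sample.\<close>
    have "expectation (\<lambda>\<omega>'. \<phi> (?H \<omega>, ?Z \<omega>')) = expectation (\<lambda>\<omega>'. next_dist ?s (I (Suc m) \<omega>', U (Suc m) \<omega>'))"
      unfolding \<phi>_def fst_conv snd_conv history_state_restrict[OF order_refl] by simp
    also have "\<dots> = (\<integral>y. next_dist ?s y \<partial>sample_measure n)"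
      unfolding sample_law[OF t, symmetric] by (rule integral_distr[symmetric]) (use meas in measurable)
    also have "\<dots> \<le> (norm (iterate ?s - xs))\<^sup>2
        - 2 * \<gamma> * (grad F (iterate ?s) \<bullet> (iterate ?s - xs) / noise_scale ?s) + \<gamma>\<^sup>2 * real CARD('d)"
      unfolding next_dist_def
    proof (rule expected_squared_distance_step[OF valid_reference_run_state \<gamma>])
      interpret pair_prob_space "uniform_count_measure {1..n}" "uniform_measure lborel (cbox (-1) 1 :: (real^'d) set)"
        by (rule prob_space_sample_measure[OF n])
      have "next_dist ?s \<in> borel_measurable (sample_measure n)"
        using meas by (subst measurable_cong_sets[OF sets_sample_measure refl])
      then have "integrable (sample_measure n) (next_dist ?s)"
        using next_bound[OF norm_run_state] by (intro P.integrable_const_bound[of _ "R\<^sup>2"]) auto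
      then show "integrable (sample_measure n)
          (\<lambda>z. (norm (iterate (signsvrg_step f n p q L D \<gamma> (fst z) (snd z) ?s) - xs))\<^sup>2)"
        by (simp add: next_dist_def[abs_def])
    qed
    also have "\<dots> \<le> (norm (iterate ?s - xs))\<^sup>2
        - 2 * \<gamma> * ((3 * sqrt_gap (iterate ?s) - \<mu>) / (4 * sqrt (2 * L))) + \<gamma>\<^sup>2 * real CARD('d)"
      using progress_lower_bound[OF valid_reference_run_state \<mu>] \<gamma>
      by (intro add_right_mono diff_left_mono mult_left_mono) auto
    finally show "expectation (\<lambda>\<omega>'. \<phi> (?H \<omega>, ?Z \<omega>')) \<le> \<dots>" .
  qed
  also have "\<dots> = expectation (\<lambda>\<omega>. (norm (iterate (run_state m \<omega>) - xs))\<^sup>2)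
      - 2 * \<gamma> * ((3 * expectation (\<lambda>\<omega>. sqrt_gap (iterate (run_state m \<omega>))) - \<mu>) / (4 * sqrt (2 * L)))
      + \<gamma>\<^sup>2 * real CARD('d)"
    using m integrable_squared_distance[of m] integrable_sqrt_gap[of m]
    by (simp add: prob_space)
  finally show ?thesis .
qed

end

section \<open>Average over the iterates\<close>

context signsvrg_run
begin

text \<open>Telescoping \<open>expected_descent\<close>: the induction carries the expected squared
  distance on the left, and at \<open>T\<close> it is dropped as nonnegative.\<close>

lemma sum_expected_sqrt_gap_bound:
  assumes \<mu>: "sqrt (2 * L) * D \<le> \<mu>" "\<mu> > 0"
  shows "\<gamma> * (3 * (\<Sum>m<T. expectation (\<lambda>\<omega>. sqrt_gap (iterate (run_state m \<omega>)))) - real T * \<mu>)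
      / (2 * sqrt (2 * L)) \<le> (norm (x1 - xs))\<^sup>2 + real T * \<gamma>\<^sup>2 * real CARD('d)"
proof -
  let ?g = "\<lambda>m. expectation (\<lambda>\<omega>. sqrt_gap (iterate (run_state m \<omega>)))"
  let ?V = "\<lambda>m. expectation (\<lambda>\<omega>. (norm (iterate (run_state m \<omega>) - xs))\<^sup>2)"
  have "?V k + \<gamma> * (3 * (\<Sum>m<k. ?g m) - real k * \<mu>) / (2 * sqrt (2 * L))
      \<le> (norm (x1 - xs))\<^sup>2 + real k * \<gamma>\<^sup>2 * real CARD('d)" if "k \<le> T" for k
    using that
  proof (induction k)
    case 0
    show ?case by (simp add: run_state_def prob_space)
  next
    case (Suc k)
    have "2 * \<gamma> * ((3 * ?g k - \<mu>) / (4 * sqrt (2 * L))) = \<gamma> * (3 * ?g k - \<mu>) / (2 * sqrt (2 * L))"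
      by simp
    then have "?V (Suc k) + \<gamma> * (3 * ?g k - \<mu>) / (2 * sqrt (2 * L)) \<le> ?V k + \<gamma>\<^sup>2 * real CARD('d)"
      using expected_descent[OF _ \<mu>, of k] Suc.prems by simp
    moreover have "\<gamma> * (3 * (\<Sum>m<Suc k. ?g m) - real (Suc k) * \<mu>) / (2 * sqrt (2 * L))
        = \<gamma> * (3 * (\<Sum>m<k. ?g m) - real k * \<mu>) / (2 * sqrt (2 * L))
          + \<gamma> * (3 * ?g k - \<mu>) / (2 * sqrt (2 * L))"
      by (simp add: add_divide_distrib[symmetric] algebra_simps)
    ultimately show ?case using Suc by (simp add: algebra_simps)
  qed
  from this[OF order_refl] have "?V T + \<gamma> * (3 * (\<Sum>m<T. ?g m) - real T * \<mu>) / (2 * sqrt (2 * L))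
      \<le> (norm (x1 - xs))\<^sup>2 + real T * \<gamma>\<^sup>2 * real CARD('d)" .
  moreover have "?V T \<ge> 0" by simp
  ultimately show ?thesis by linarith
qed

text \<open>Independence of \<open>J\<close> from all samples allows it to be frozen first; the
  inner expectations at fixed times are then averaged. The shift by one occurs because the iterate
  at time \<open>j\<close> is the state after \<open>j - 1\<close> steps.\<close>

lemma expectation_sqrt_gap_uniform_index:
  fixes J :: "'w \<Rightarrow> nat"
  assumes T: "T \<ge> 1"
    and J: "distr M (count_space {1..T}) J = uniform_count_measure {1..T}"
    and indep: "indep_pair (count_space {1..T}) J (\<Pi>\<^sub>M t\<in>{1..T}. sample_space)
      (\<lambda>\<omega>. \<lambda>t\<in>{1..T}. (I t \<omega>, U t \<omega>))"
  shows "integrable M (\<lambda>\<omega>. sqrt_gap (iterate (run_state (J \<omega> - 1) \<omega>)))"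
    and "expectation (\<lambda>\<omega>. sqrt_gap (iterate (run_state (J \<omega> - 1) \<omega>)))
      = (\<Sum>m<T. expectation (\<lambda>\<omega>. sqrt_gap (iterate (run_state m \<omega>)))) / real T"
proof -
  let ?S = "\<Pi>\<^sub>M t\<in>{1..T}. sample_space" and ?H = "\<lambda>\<omega>. \<lambda>t\<in>{1..T}. (I t \<omega>, U t \<omega>)"
  define \<phi> where "\<phi> w = sqrt_gap (iterate (history_state (fst w - 1) (snd w)))"
    for w :: "nat \<times> (nat \<Rightarrow> nat \<times> (real^'d))"
  have rv[measurable]: "random_variable (count_space {1..T}) J" "random_variable ?S ?H"
    using indep by (auto simp: indep_pair_def)
  note law = indep_pair_distr[OF indep]
  have J_range: "J \<omega> \<in> {1..T}" if "\<omega> \<in> space M" for \<omega>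
    using measurable_space[OF rv(1) that] by simp
  have meas[measurable]: "\<phi> \<in> borel_measurable (count_space {1..T} \<Otimes>\<^sub>M ?S)"
    unfolding \<phi>_def
  proof (rule measurable_compose_countable'[OF _ measurable_fst])
    fix j assume "j \<in> {1..T}"
    then have "(\<lambda>w. iterate (history_state (j - 1) (snd w))) \<in> borel_measurable (count_space {1..T} \<Otimes>\<^sub>M ?S)"
      by (intro borel_measurable_history_state(1)[of _ "{1..T}"]) auto
    then show "(\<lambda>w. sqrt_gap (iterate (history_state (j - 1) (snd w))))
        \<in> borel_measurable (count_space {1..T} \<Otimes>\<^sub>M ?S)"
      by measurable
  qed simp
  obtain B where B: "\<And>x. norm (x - xs) \<le> norm (x1 - xs) + real T * (\<gamma> * sqrt (real CARD('d)))
      \<Longrightarrow> sqrt_gap x \<le> B"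
    using sqrt_gap_bounded_on_cball by blast
  have bound: "\<bar>\<phi> w\<bar> \<le> B" if "w \<in> space (count_space {1..T} \<Otimes>\<^sub>M ?S)" for w
  proof -
    have "fst w \<in> {1..T}" using that by (auto simp: space_pair_measure)
    then have "real (fst w - 1) * (\<gamma> * sqrt (real CARD('d))) \<le> real T * (\<gamma> * sqrt (real CARD('d)))"
      using \<gamma> by (intro mult_right_mono) auto
    then have "norm (iterate (history_state (fst w - 1) (snd w)) - xs)
        \<le> norm (x1 - xs) + real T * (\<gamma> * sqrt (real CARD('d)))"
      using norm_iterate_signsvrg_state[OF \<gamma>, of D "\<lambda>t. fst (snd w t)" "\<lambda>t. snd (snd w t)" x1 "fst w - 1"]
      unfolding history_state_def by linarith
    from B[OF this] show ?thesis using sqrt_gap_nonneg by (simp add: \<phi>_def)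
  qed
  have run: "\<phi> (j, ?H \<omega>) = sqrt_gap (iterate (run_state (j - 1) \<omega>))" if "j \<in> {1..T}" for j \<omega>
    unfolding \<phi>_def fst_conv snd_conv using that by (subst history_state_restrict) auto
  have "integrable M (\<lambda>\<omega>. \<phi> (J \<omega>, ?H \<omega>))"
  proof (rule integrable_const_bound[of _ B])
    show "AE \<omega> in M. norm (\<phi> (J \<omega>, ?H \<omega>)) \<le> B"
      using bound measurable_space[OF rv(1)] measurable_space[OF rv(2)]
      by (intro AE_I2) (simp add: space_pair_measure)
    show "(\<lambda>\<omega>. \<phi> (J \<omega>, ?H \<omega>)) \<in> borel_measurable M"
      by (rule measurable_compose[OF measurable_Pair[OF rv] meas])
  qed
  then show "integrable M (\<lambda>\<omega>. sqrt_gap (iterate (run_state (J \<omega> - 1) \<omega>)))"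
    by (rule Bochner_Integration.integrable_cong[THEN iffD1, rotated 2]) (auto simp only: run J_range)
  define e where "e j = expectation (\<lambda>\<omega>. \<phi> (j, ?H \<omega>))" for j
  have "expectation (\<lambda>\<omega>. sqrt_gap (iterate (run_state (J \<omega> - 1) \<omega>))) = expectation (\<lambda>\<omega>. \<phi> (J \<omega>, ?H \<omega>))"
    by (rule Bochner_Integration.integral_cong) (auto simp only: run J_range)
  also have "\<dots> = expectation (\<lambda>\<omega>. e (J \<omega>))"
    unfolding e_def by (rule expectation_product_law(2)[OF rv law meas bound])
  also have "\<dots> = integral\<^sup>L (uniform_count_measure {1..T}) e"
    unfolding J[symmetric] by (rule integral_distr[OF rv(1), symmetric]) simp
  also have "\<dots> = (\<Sum>j\<in>{1..T}. e j) / real T"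
    by (subst integral_uniform_count_measure) auto
  also have "(\<Sum>j\<in>{1..T}. e j) = (\<Sum>j\<in>{1..T}. expectation (\<lambda>\<omega>. sqrt_gap (iterate (run_state (j - 1) \<omega>))))"
    unfolding e_def by (intro sum.cong refl Bochner_Integration.integral_cong run)
  also have "\<dots> = (\<Sum>m<T. expectation (\<lambda>\<omega>. sqrt_gap (iterate (run_state m \<omega>))))"
    by (rule sum.reindex_bij_witness[of _ Suc "\<lambda>j. j - 1"]) auto
  finally show "expectation (\<lambda>\<omega>. sqrt_gap (iterate (run_state (J \<omega> - 1) \<omega>)))
      = (\<Sum>m<T. expectation (\<lambda>\<omega>. sqrt_gap (iterate (run_state m \<omega>)))) / real T" .
qed

end

text \<open>The step size gives \<open>T * \<gamma>^2 * d = \<alpha>^2\<close> and turns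
  \<open>R^2 + \<alpha>^2\<close> into \<open>\<gamma> * sqrt T * C\<close>, with \<open>C\<close>
  the second argument of the maximum. Hence \<open>3 * S\<close> is at most \<open>T * \<mu>\<close>
  plus two terms that are each at most \<open>T * \<mu>\<close>.\<close>

lemma average_bound_of_telescoped:
  fixes L T d R \<alpha> P S :: real
  assumes pos: "L > 0" "T > 0" "d > 0" "\<alpha> > 0"
    and \<gamma>: "\<gamma> = \<alpha> / sqrt (d * T)"
    and \<mu>: "\<mu> = sqrt (2 * L / T) * max P (sqrt d * (R\<^sup>2 / \<alpha> + \<alpha>))"
    and le: "\<gamma> * (3 * S - T * \<mu>) / (2 * sqrt (2 * L)) \<le> R\<^sup>2 + T * \<gamma>\<^sup>2 * d"
  shows "S / T \<le> \<mu>"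
proof -
  define a where "a = sqrt (2 * L)"
  define C where "C = sqrt d * (R\<^sup>2 / \<alpha> + \<alpha>)"
  have a: "a > 0" and sT: "sqrt T > 0" using pos by (auto simp: a_def)
  have T: "T = sqrt T * sqrt T" using pos by simp
  have \<gamma>0: "\<gamma> > 0" using pos by (simp add: \<gamma>)
  have \<gamma>2: "T * \<gamma>\<^sup>2 * d = \<alpha>\<^sup>2" using pos by (simp add: \<gamma> power_divide)
  have "R\<^sup>2 + \<alpha>\<^sup>2 = \<gamma> * (sqrt T * C)"
    using pos by (simp add: \<gamma> C_def real_sqrt_mult field_simps power2_eq_square)
  with le have "\<gamma> * (3 * S - T * \<mu>) \<le> \<gamma> * (2 * (a * (sqrt T * C)))"
    using a unfolding \<gamma>2 a_def[symmetric] by (simp add: field_simps)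
  then have "3 * S \<le> T * \<mu> + 2 * (a * (sqrt T * C))"
    using \<gamma>0 by (simp add: mult_le_cancel_left_pos)
  also have "a * (sqrt T * C) \<le> T * \<mu>"
  proof -
    have "T * \<mu> = a * (sqrt T * max P C)"
      using sT unfolding \<mu> C_def[symmetric] real_sqrt_divide a_def[symmetric]
      by (subst T) (simp del: real_sqrt_mult_self)
    then show ?thesis using a sT by (simp add: mult_left_mono)
  qed
  finally show ?thesis using pos by (simp add: field_simps)
qed

theorem corollary2:
  fixes f :: "nat \<Rightarrow> real^'d \<Rightarrow> real"
    and n T :: nat
    and p q :: ereal
    and L P \<alpha> \<gamma> D :: real
    and x1 xs :: "real^'d"
    and M :: "'w measure"
    and I :: "nat \<Rightarrow> 'w \<Rightarrow> nat"
    and U :: "nat \<Rightarrow> 'w \<Rightarrow> real^'d"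
    and J :: "'w \<Rightarrow> nat"
  assumes "n \<ge> 1" and "T \<ge> 1"
    and "1 \<le> p" and "1 \<le> q" and "1 / p + 1 / q = 1"
    and "\<And>i. i \<in> {1..n} \<Longrightarrow> cont_differentiable (f i)"
    and "L > 0"
    and "\<And>i x y. i \<in> {1..n} \<Longrightarrow>
           lr_norm p (grad (f i) x - grad (f i) y) \<le> L * lr_norm q (x - y)"
    and "convex_on UNIV (avg_fun f n)"
    and "\<And>x. avg_fun f n xs \<le> avg_fun f n x"
    and "P > 0" and "\<alpha> > 0"
    and "\<gamma> = \<alpha> / sqrt (real CARD('d) * real T)"
    and "D = P / sqrt (real T)"
    \<comment> \<open>the samples \<open>i\<^sub>t\<close> and \<open>U\<^sub>t\<close>, and the uniform output index\<close>
    and "prob_space M"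
    and "\<And>t. t \<in> {1..T} \<Longrightarrow> distr M (count_space {1..n}) (I t) = uniform_count_measure {1..n}"
    and "\<And>t. t \<in> {1..T} \<Longrightarrow>
           distr M borel (U t) = uniform_measure lborel {u. \<forall>i. u $ i \<in> {-1..1}}"
    and "\<And>t. t \<in> {1..T} \<Longrightarrow> prob_space.indep_pair M (count_space {1..n}) (I t) borel (U t)"
    and "prob_space.indep_vars M (\<lambda>t. count_space {1..n} \<Otimes>\<^sub>M borel) (\<lambda>t \<omega>. (I t \<omega>, U t \<omega>)) {1..T}"
    and "distr M (count_space {1..T}) J = uniform_count_measure {1..T}"
    and "prob_space.indep_pair M (count_space {1..T}) J
           (\<Pi>\<^sub>M t\<in>{1..T}. count_space {1..n} \<Otimes>\<^sub>M borel) (\<lambda>\<omega>. \<lambda>t\<in>{1..T}. (I t \<omega>, U t \<omega>))"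
  defines "gap \<equiv> \<lambda>\<omega>. avg_fun f n
             (signsvrg_iterate f n p q L D \<gamma> (\<lambda>t. I t \<omega>) (\<lambda>t. U t \<omega>) x1 (J \<omega>)) - avg_fun f n xs"
  shows "integrable M (\<lambda>\<omega>. sqrt (gap \<omega>)) \<and>
         prob_space.expectation M (\<lambda>\<omega>. sqrt (gap \<omega>))
           \<le> sqrt (2 * L / real T) * max P (sqrt (real CARD('d)) * ((norm (x1 - xs))\<^sup>2 / \<alpha> + \<alpha>))"
proof -
  note T = \<open>T \<ge> 1\<close> and J = \<open>distr M (count_space {1..T}) J = uniform_count_measure {1..T}\<close>
  interpret signsvrg_problem f n p q L xs
    by (rule signsvrg_problem.intro) fact+
  interpret signsvrg_run f n p q L xs M I U T x1 \<gamma> D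
  proof (intro signsvrg_run.intro signsvrg_run_axioms.intro)
    show "signsvrg_problem f n p q L xs" by unfold_locales
    show "\<gamma> \<ge> 0" "D \<ge> 0"
      using \<open>P > 0\<close> \<open>\<alpha> > 0\<close> by (simp_all add: \<open>\<gamma> = _\<close> \<open>D = _\<close>)
    show "distr M borel (U t) = uniform_measure lborel (cbox (-1) 1)" if "t \<in> {1..T}" for t
      unfolding sample_box_eq_cbox[symmetric] using that by fact
  qed fact+
  define \<mu> where "\<mu> = sqrt (2 * L / real T) * max P (sqrt (real CARD('d)) * ((norm (x1 - xs))\<^sup>2 / \<alpha> + \<alpha>))"
  define S where "S = (\<Sum>m<T. expectation (\<lambda>\<omega>. sqrt_gap (iterate (run_state m \<omega>))))"
  have "\<mu> > 0"
    unfolding \<mu>_def using \<open>L > 0\<close> \<open>P > 0\<close> T by (intro mult_pos_pos) auto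
  \<comment> \<open>This is where the argument \<open>P\<close> of the maximum enters, through the
    choice of \<open>D\<close>; the other argument is used in
    \<open>average_bound_of_telescoped\<close>.\<close>
  moreover have "sqrt (2 * L) * D \<le> \<mu>"
  proof -
    have "sqrt (2 * L) * D = sqrt (2 * L / real T) * P"
      by (simp add: \<open>D = _\<close> real_sqrt_divide)
    also have "\<dots> \<le> \<mu>"
      unfolding \<mu>_def using \<open>L > 0\<close> by (intro mult_left_mono) auto
    finally show ?thesis .
  qed
  ultimately have "S / real T \<le> \<mu>"
    using sum_expected_sqrt_gap_bound[of \<mu>] \<open>L > 0\<close> \<open>\<alpha> > 0\<close> T
    by (intro average_bound_of_telescoped[of L "real T" "real CARD('d)" \<alpha> \<gamma> \<mu> P "norm (x1 - xs)" S])
      (auto simp: \<mu>_def S_def \<open>\<gamma> = _\<close>)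
  moreover have "sqrt (gap \<omega>) = sqrt_gap (iterate (run_state (J \<omega> - 1) \<omega>))" for \<omega>
    by (simp add: gap_def sqrt_gap_def run_state_def signsvrg_iterate_def)
  moreover note expectation_sqrt_gap_uniform_index[OF T J]
  ultimately show ?thesis
    using \<open>indep_pair (count_space {1..T}) J _ _\<close> by (simp add: \<mu>_def S_def)
qed

end
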